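(* Let $a>0$, let $q\in L^2(0,a)$ be complex-valued, and let $\alpha_0\ge0$, $\alpha>0$, $\beta_0,\beta\in\mathbb{C}$. Assume that $\Delta_+(0)\ne0$, $q(x)=q(a-x)$, $\alpha=\alpha_0$ and $\beta=\beta_0$. Then all the eigenvalues $\{\lambda_k^+\}$ (including multiplicity) of the problem $L(q,\alpha_0,\beta_0,\alpha,\beta)=L(q,\alpha,\beta,\alpha,\beta)$ uniquely determine $\alpha$, $\beta$ and $q(x)$ a.e. on $(0,a)$.
   Context: $L(q,\alpha_0,\beta_0,\alpha,\beta)$ denotes the boundary value problem $$-y''+q(x)y=\lambda^2y,\ x\in(0,a),\qquad y'(0)-(i\alpha_0\lambda+\beta_0)y(0)=0,\qquad y'(a)+(i\alpha\lambda+\beta)y(a)=0,$$ with spectral parameter $\lambda\in\mathbb{C}$. Let $y(\lambda,x)$ be the solution of $-y''+qy=\lambda^2y$ with $y(\lambda,0)=1$, $y'(\lambda,0)=i\alpha_0\lambda+\beta_0$. The characteristic function is the entire function $\Delta_+(\lambda)=y'(\lambda,a)+(i\alpha\lambda+\beta)y(\lambda,a)$; the eigenvalues of the problem are its zeros, with their multiplicities. "Uniquely determine" means: if two problems of this form (same $a$) both satisfy the hypotheses and have the same data (here: the same eigenvalues with multiplicities), then the listed unknowns coincide. *)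

theory Defs
  imports "HOL-Complex_Analysis.Complex_Analysis"
begin

definition L2_on :: "real \<Rightarrow> (real \<Rightarrow> complex) \<Rightarrow> bool" where
  "L2_on a q \<longleftrightarrow> q \<in> borel_measurable (lebesgue_on {0<..<a}) \<and>
     integrable (lebesgue_on {0<..<a}) (\<lambda>x. (norm (q x))\<^sup>2)"

text \<open>Solutions are understood in the usual sense for an integrable potential: \<open>y\<close> is
  differentiable on \<open>[0,a]\<close> with derivative \<open>y'\<close>, the function \<open>y'\<close> is absolutely continuous,
  that is, an indefinite Lebesgue integral of an integrable function \<open>y''\<close>, and the equation
  holds almost everywhere. The derivatives at \<open>0\<close> and \<open>a\<close> are one-sided.
  The spectral parameter is written \<open>\<mu>\<close> and enters the equation as \<open>\<mu>\<^sup>2\<close>.\<close>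

definition sl_solution ::
  "real \<Rightarrow> (real \<Rightarrow> complex) \<Rightarrow> complex \<Rightarrow> (real \<Rightarrow> complex) \<Rightarrow> (real \<Rightarrow> complex) \<Rightarrow> bool" where
  "sl_solution a q \<mu> y y' \<longleftrightarrow>
     (\<forall>x\<in>{0..a}. (y has_vector_derivative y' x) (at x within {0..a})) \<and>
     (\<exists>y''. y'' absolutely_integrable_on {0..a} \<and>
        (\<forall>x\<in>{0..a}. (y'' has_integral (y' x - y' 0)) {0..x}) \<and>
        (AE x in lebesgue_on {0<..<a}. - y'' x + q x * y x = \<mu>\<^sup>2 * y x))"

text \<open>The solution of the initial value problem is unique only as a function on \<open>[0,a]\<close>, so the
  description operator is applied to the value of the boundary form at \<open>a\<close>, which depends
  only on the restriction to \<open>[0,a]\<close>.\<close>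

definition char_fun ::
  "real \<Rightarrow> (real \<Rightarrow> complex) \<Rightarrow> real \<Rightarrow> complex \<Rightarrow> real \<Rightarrow> complex \<Rightarrow> complex \<Rightarrow> complex" where
  "char_fun a q \<alpha>\<^sub>0 \<beta>\<^sub>0 \<alpha> \<beta> \<mu> =
     (THE d. \<exists>y y'. sl_solution a q \<mu> y y' \<and>
        y 0 = 1 \<and> y' 0 = \<i> * of_real \<alpha>\<^sub>0 * \<mu> + \<beta>\<^sub>0 \<and>
        d = y' a + (\<i> * of_real \<alpha> * \<mu> + \<beta>) * y a)"

definition eigenvalues ::
  "real \<Rightarrow> (real \<Rightarrow> complex) \<Rightarrow> real \<Rightarrow> complex \<Rightarrow> real \<Rightarrow> complex \<Rightarrow> complex set" where
  "eigenvalues a q \<alpha>\<^sub>0 \<beta>\<^sub>0 \<alpha> \<beta> = {\<mu>. char_fun a q \<alpha>\<^sub>0 \<beta>\<^sub>0 \<alpha> \<beta> \<mu> = 0}"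

text \<open>The characteristic function is entire, so \<open>zorder\<close> is the order of vanishing at each of
  its zeros, provided that it does not vanish identically.\<close>

definition eigenvalue_mult ::
  "real \<Rightarrow> (real \<Rightarrow> complex) \<Rightarrow> real \<Rightarrow> complex \<Rightarrow> real \<Rightarrow> complex \<Rightarrow> complex \<Rightarrow> int" where
  "eigenvalue_mult a q \<alpha>\<^sub>0 \<beta>\<^sub>0 \<alpha> \<beta> \<mu> = zorder (char_fun a q \<alpha>\<^sub>0 \<beta>\<^sub>0 \<alpha> \<beta>) \<mu>"

end

theory Submission imports Defs begin

text \<open>
  Put \<open>z = \<mu>\<^sup>2\<close> and let \<open>S(z)\<close> be the value at \<open>a\<close> of the solution with data \<open>(0,1)\<close> at \<open>0\<close>, and
  \<open>A(z)\<close>, \<open>D(z)\<close> the values at \<open>a\<close> of \<open>\<phi>\<close> and \<open>d\<phi>/dx + \<beta>\<phi>\<close> for the solution \<open>\<phi>\<close> with data \<open>(1,\<beta>)\<close>.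
  These are entire functions of \<open>z\<close>. If the potential is symmetric, reflection in the midpoint
  gives
  \<open>\<Delta>(\<mu>) = D + 2 i \<alpha> \<mu> A - \<alpha>\<^sup>2 \<mu>\<^sup>2 S\<close>, and the Wronskian gives \<open>A\<^sup>2 - S D = 1\<close>.

  \<^emph>\<open>The zeros give the characteristic function up to a factor.\<close> Two characteristic functions with
  the same zeros have a zero-free entire quotient, and both are of exponential type; by the
  simplest case of Hadamard's factorization theorem
  (\<open>zero_free_quotient_of_exponential_type\<close>) the quotient is \<open>exp (b\<mu> + c)\<close>. Because \<open>\<alpha> > 0\<close>, the
  leading term \<open>(i\<mu>/2) ((1+\<alpha>)\<^sup>2 e\<^sup>i\<^sup>\<mu>\<^sup>a - (1-\<alpha>)\<^sup>2 e\<^sup>-\<^sup>i\<^sup>\<mu>\<^sup>a)\<close> dominates in the whole closed lower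
  half-plane, so the quotient is bounded above and below there, and \<open>b = 0\<close>.

  \<^emph>\<open>The characteristic function gives \<open>\<alpha>\<close>, \<open>A\<close>, \<open>D\<close> and \<open>S\<close>.\<close> From now on primes refer to the second problem. If \<open>\<Delta>' = K \<Delta>\<close>, the odd parts together
  with \<open>A \<sim> cos (\<mu> a)\<close> give \<open>\<alpha>' = K \<alpha>\<close> and \<open>A' = A\<close>. The even parts give the sum of \<open>D\<close> and
  \<open>T = - \<alpha>\<^sup>2 z S\<close>, and \<open>A\<^sup>2 - S D = 1\<close> gives their product, so \<open>D'\<close> is either \<open>K D\<close> or \<open>K T\<close>.
  The second is impossible, as \<open>T(0) = 0\<close> while \<open>D(0) = \<Delta>(0) \<noteq> 0\<close>; this is where the hypothesis at
  \<open>\<mu> = 0\<close> enters, and without it \<open>\<alpha>\<close> and \<open>1/\<alpha>\<close> could be confused. Comparing the growth of \<open>D'\<close>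
  and \<open>K D\<close> gives \<open>K = 1\<close>.

  \<^emph>\<open>These functions give the potential.\<close> For a fixed \<open>x\<close> consider \<open>G = \<phi> s' - s \<phi>'\<close>, where \<open>s\<close> is the
  solution with data \<open>(0,1)\<close>. By reflection, \<open>\<Delta> G\<close> is a
  combination of products of solutions at \<open>x\<close> and at \<open>a - x\<close>, hence of size \<open>e\<^bsup>|Im \<mu>| a\<^esup>\<close>; the lower
  bound for \<open>\<Delta>\<close> makes \<open>G\<close> decay in the lower half-plane, and \<open>G\<close> is even in \<open>\<mu>\<close>. By Liouville
  \<open>G = 0\<close> (\<open>cross_product_vanishes\<close>). Differentiating in \<open>x\<close> and using the Wronskians, \<open>\<phi>\<^sup>2 = \<phi>'\<^sup>2\<close>.
  For \<open>\<mu> = i t\<close> with \<open>t\<close> large both functions are close to \<open>cosh (t x)\<close>, so \<open>\<phi> = \<phi>'\<close> has no zero on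
  \<open>[0,a]\<close>, and the differential equation returns \<open>q = q'\<close> and \<open>\<beta> = \<beta>'\<close>.
\<close>

section \<open>Absolutely continuous functions as indefinite integrals\<close>

text \<open>This is absolute continuity of \<open>F\<close> on \<open>[0,a]\<close> with almost everywhere derivative \<open>f\<close>, stated as the
  integral identity, so that \<open>f\<close> may be changed on null sets and \<open>F\<close> need not be differentiated.\<close>

definition primitive_on :: "real \<Rightarrow> (real \<Rightarrow> complex) \<Rightarrow> (real \<Rightarrow> complex) \<Rightarrow> bool" where
  "primitive_on a F f \<longleftrightarrow> f absolutely_integrable_on {0..a} \<and>
     (\<forall>x\<in>{0..a}. (f has_integral (F x - F 0)) {0..x})"

lemma absolutely_integrable_mult_continuous:
  fixes f g :: "real \<Rightarrow> complex"
  assumes f: "f absolutely_integrable_on {u..v}" and g: "continuous_on {u..v} g"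
  shows "(\<lambda>x. f x * g x) absolutely_integrable_on {u..v}"
proof -
  have bl: "bilinear (\<lambda>x y::complex. y * x)"
    unfolding bilinear_def by (auto intro!: linearI simp: algebra_simps)
  have "(\<lambda>x. (\<lambda>x y. y * x) (g x) (f x)) absolutely_integrable_on {u..v}"
  proof (rule absolutely_integrable_bounded_measurable_product[OF bl])
    show "g \<in> borel_measurable (lebesgue_on {u..v})"
      using g by (intro continuous_imp_measurable_on_sets_lebesgue) auto
    show "bounded (g ` {u..v})"
      using g by (intro compact_imp_bounded compact_continuous_image) auto
  qed (use f in auto)
  then show ?thesis by simp
qed

lemma primitive_on_has_integral:
  assumes "primitive_on a F f" "0 \<le> x" "x \<le> y" "y \<le> a"
  shows "(f has_integral (F y - F x)) {x..y}"
proof -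
  have x: "(f has_integral (F x - F 0)) {0..x}" and y: "(f has_integral (F y - F 0)) {0..y}"
    using assms by (auto simp: primitive_on_def)
  have "f integrable_on {0..y}" using y by blast
  then have "integral {0..x} f + integral {x..y} f = integral {0..y} f" and "f integrable_on {x..y}"
    using assms by (auto intro!: Henstock_Kurzweil_Integration.integral_combine
        integrable_subinterval_real[OF \<open>f integrable_on {0..y}\<close>])
  moreover have "integral {0..x} f = F x - F 0" "integral {0..y} f = F y - F 0"
    using x y by (auto intro: integral_unique)
  ultimately show ?thesis
    by (auto simp: has_integral_iff algebra_simps)
qed

lemma primitive_on_continuous:
  assumes "primitive_on a F f"
  shows "continuous_on {0..a} F"
proof (cases "0 \<le> a")
  case True
  have "f integrable_on {0..a}"
    using assms True by (auto simp: primitive_on_def)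
  then have "continuous_on {0..a} (\<lambda>x. F 0 + integral {0..x} f)"
    by (intro continuous_intros indefinite_integral_continuous_1)
  moreover have "F 0 + integral {0..x} f = F x" if "x \<in> {0..a}" for x
    proof -
    have "integral {0..x} f = F x - F 0"
      using assms that by (intro integral_unique) (auto simp: primitive_on_def)
    then show ?thesis by simp
  qed
  ultimately show ?thesis using continuous_on_cong[of "{0..a}" "{0..a}" "\<lambda>x. F 0 + integral {0..x} f" F] by blast
qed auto

text \<open>Cut \<open>[0,x]\<close> into equal pieces shorter than \<open>\<delta>\<close>; the increments of \<open>h\<close> add up to at most
  \<open>\<epsilon> (V x - V 0)\<close>, for every \<open>\<epsilon>\<close>. Here \<open>V\<close> will be the integral of an integrable function, for
  which increments need not be of the order of the length of the piece.\<close>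

lemma constant_if_small_increments:
  fixes h :: "real \<Rightarrow> 'a :: real_normed_vector" and V :: "real \<Rightarrow> real"
  assumes inc: "\<And>\<epsilon>. \<epsilon> > 0 \<Longrightarrow> \<exists>\<delta>>0. \<forall>x y. 0 \<le> x \<longrightarrow> x \<le> y \<longrightarrow> y \<le> a \<longrightarrow> y - x < \<delta> \<longrightarrow>
                     norm (h y - h x) \<le> \<epsilon> * (V y - V x)"
    and x: "0 \<le> x" "x \<le> a"
  shows "h x = h 0"
proof -
  have bound: "norm (h x - h 0) \<le> \<epsilon> * (V x - V 0)" if e: "\<epsilon> > 0" for \<epsilon>
  proof -
    obtain \<delta> where \<delta>: "\<delta> > 0" and D: "\<And>x y. 0 \<le> x \<Longrightarrow> x \<le> y \<Longrightarrow> y \<le> a \<Longrightarrow> y - x < \<delta> \<Longrightarrow>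
                     norm (h y - h x) \<le> \<epsilon> * (V y - V x)"
      using inc[OF e] by auto
    obtain n :: nat where n: "x / \<delta> < real n" using reals_Archimedean2 by blast
    have n0: "real n > 0" using n x \<delta> by (smt (verit) divide_nonneg_pos)
    have step: "x / real n < \<delta>" using n n0 \<delta> by (simp add: field_simps)
    have "k \<le> n \<Longrightarrow> norm (h (real k * x / real n) - h 0) \<le> \<epsilon> * (V (real k * x / real n) - V 0)" for k
    proof (induction k)
      case (Suc k)
      let ?u = "real k * x / real n" and ?w = "real (Suc k) * x / real n"
      have d: "?w - ?u = x / real n" by (simp add: algebra_simps add_divide_distrib)
      have "real (Suc k) * x \<le> real n * x" using Suc.prems x by (intro mult_right_mono) auto
      then have "?w \<le> x" using n0 by (simp add: pos_divide_le_eq mult.commute)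
      then have wa: "?w \<le> a" using x by linarith
      have u0: "0 \<le> ?u" using x by simp
      have "x / real n \<ge> 0" using x by simp
      then have uw: "?u \<le> ?w" using d by linarith
      have "norm (h ?w - h ?u) \<le> \<epsilon> * (V ?w - V ?u)"
        by (rule D[OF u0 uw wa]) (use d step in simp)
      moreover have "norm (h ?u - h 0) \<le> \<epsilon> * (V ?u - V 0)" using Suc by simp
      moreover have "norm (h ?w - h 0) \<le> norm (h ?w - h ?u) + norm (h ?u - h 0)"
        using norm_triangle_ineq[of "h ?w - h ?u" "h ?u - h 0"] by simp
      ultimately show ?case by (simp add: algebra_simps)
    qed simp
    from this[of n] show ?thesis using n0 by simp
  qed
  have "norm (h x - h 0) \<le> 0 + e" if "e > 0" for e
  proof -
    have "norm (h x - h 0) \<le> (e / (\<bar>V x - V 0\<bar> + 1)) * (V x - V 0)"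
      using bound[of "e / (\<bar>V x - V 0\<bar> + 1)"] that by simp
    also have "\<dots> \<le> (e / (\<bar>V x - V 0\<bar> + 1)) * (\<bar>V x - V 0\<bar> + 1)"
      by (intro mult_left_mono) (use that in auto)
    also have "\<dots> = e" by (simp add: add_nonneg_pos less_imp_neq)
    finally show ?thesis by simp
  qed
  then have "norm (h x - h 0) \<le> 0" by (rule field_le_epsilon)
  then show ?thesis by simp
qed

lemma primitive_on_of_integral:
  assumes "f absolutely_integrable_on {0..a}"
  shows "primitive_on a (\<lambda>x. c + integral {0..x} f) f"
proof -
  have "f integrable_on {0..x}" if "x \<in> {0..a}" for x
    using that by (auto intro!: integrable_subinterval_real[OF set_lebesgue_integral_eq_integral(1)[OF assms]])
  then show ?thesis using assms unfolding primitive_on_def by (simp add: has_integral_integral)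
qed

text \<open>The product rule behind every Wronskian and variation of constants argument below. On a short
  interval \<open>[x,y]\<close> the product increment is \<open>(F y - F x) G y + F x (G y - G x)\<close>; replacing \<open>G y\<close> and
  \<open>F x\<close> by the running values \<open>G t\<close> and \<open>F t\<close> under the integrals costs at most the oscillation of
  \<open>F\<close> and \<open>G\<close> times the integral of \<open>|f| + |g|\<close>.\<close>

theorem primitive_on_mult:
  assumes F: "primitive_on a F f" and G: "primitive_on a G g"
  shows "primitive_on a (\<lambda>x. F x * G x) (\<lambda>x. f x * G x + F x * g x)"
proof -
  let ?k = "\<lambda>x. f x * G x + F x * g x"
  have cF: "continuous_on {0..a} F" and cG: "continuous_on {0..a} G"
    using F G primitive_on_continuous by auto
  have af: "f absolutely_integrable_on {0..a}" and ag: "g absolutely_integrable_on {0..a}"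
    using F G by (auto simp: primitive_on_def)
  have ak: "?k absolutely_integrable_on {0..a}"
    using set_integral_add(1)[OF absolutely_integrable_mult_continuous[OF af cG]
        absolutely_integrable_mult_continuous[OF ag cF]] by (simp add: mult.commute)
  define n where "n t = norm (f t) + norm (g t)" for t
  have nint: "n integrable_on {0..a}"
    using af ag unfolding n_def by (intro integrable_add) (auto simp: absolutely_integrable_on_def)
  define V where "V x = integral {0..x} n" for x
  define h where "h x = F x * G x - integral {0..x} ?k" for x
  have "h x = h 0" if x: "x \<in> {0..a}" for x
  proof (rule constant_if_small_increments[of a h V])
    fix \<epsilon> :: real assume e: "\<epsilon> > 0"
    have uF: "uniformly_continuous_on {0..a} F" and uG: "uniformly_continuous_on {0..a} G"
      using cF cG by (auto intro: compact_uniformly_continuous)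
    obtain d1 where d1: "d1 > 0" "\<And>x y. x \<in> {0..a} \<Longrightarrow> y \<in> {0..a} \<Longrightarrow> dist y x < d1 \<Longrightarrow> dist (F y) (F x) < \<epsilon>"
      using uF e unfolding uniformly_continuous_on_def by metis
    obtain d2 where d2: "d2 > 0" "\<And>x y. x \<in> {0..a} \<Longrightarrow> y \<in> {0..a} \<Longrightarrow> dist y x < d2 \<Longrightarrow> dist (G y) (G x) < \<epsilon>"
      using uG e unfolding uniformly_continuous_on_def by metis
    show "\<exists>\<delta>>0. \<forall>x y. 0 \<le> x \<longrightarrow> x \<le> y \<longrightarrow> y \<le> a \<longrightarrow> y - x < \<delta> \<longrightarrow> norm (h y - h x) \<le> \<epsilon> * (V y - V x)"
    proof (intro exI[of _ "min d1 d2"] conjI allI impI)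
      fix x y assume xy: "0 \<le> x" "x \<le> y" "y \<le> a" "y - x < min d1 d2"
      have fi: "(f has_integral (F y - F x)) {x..y}" and gi: "(g has_integral (G y - G x)) {x..y}"
        using F G xy by (auto intro: primitive_on_has_integral)
      have kI: "(?k has_integral (integral {0..y} ?k - integral {0..x} ?k)) {x..y}"
        using primitive_on_has_integral[OF primitive_on_of_integral[OF ak, of 0]] xy by simp
      have ni: "n integrable_on {0..y}" "n integrable_on {x..y}"
        by (rule integrable_subinterval_real[OF nint], use xy in simp)+
      have "integral {0..x} n + integral {x..y} n = integral {0..y} n"
        by (rule Henstock_Kurzweil_Integration.integral_combine[OF xy(1,2) ni(1)])
      then have "integral {x..y} n = V y - V x" by (simp add: V_def)
      then have nI: "(n has_integral (V y - V x)) {x..y}"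
        using ni(2) by (simp add: has_integral_iff)
      have "((\<lambda>t. f t * G y + F x * g t - ?k t) has_integral
              ((F y - F x) * G y + F x * (G y - G x) - (integral {0..y} ?k - integral {0..x} ?k))) {x..y}"
        by (intro has_integral_diff has_integral_add has_integral_mult_left has_integral_mult_right fi gi kI)
      also have "(F y - F x) * G y + F x * (G y - G x) - (integral {0..y} ?k - integral {0..x} ?k) = h y - h x"
        by (simp add: h_def algebra_simps)
      finally have hI: "((\<lambda>t. f t * G y + F x * g t - ?k t) has_integral (h y - h x)) {x..y}" .
      have "norm (integral {x..y} (\<lambda>t. f t * G y + F x * g t - ?k t)) \<le> integral {x..y} (\<lambda>t. \<epsilon> * n t)"
      proof (rule integral_norm_bound_integral)
        fix t assume t: "t \<in> {x..y}"
        have "dist (G y) (G t) < \<epsilon>" by (rule d2(2)) (use t xy in \<open>auto simp: dist_real_def\<close>)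
        moreover have "dist (F t) (F x) < \<epsilon>" by (rule d1(2)) (use t xy in \<open>auto simp: dist_real_def\<close>)
        ultimately have GF: "norm (G y - G t) \<le> \<epsilon>" "norm (F x - F t) \<le> \<epsilon>"
          by (simp_all add: dist_norm norm_minus_commute)
        have "f t * G y + F x * g t - ?k t = f t * (G y - G t) + (F x - F t) * g t"
          by (simp add: algebra_simps)
        also have "norm \<dots> \<le> norm (f t) * norm (G y - G t) + norm (F x - F t) * norm (g t)"
          by (metis norm_mult norm_triangle_ineq)
        also have "\<dots> \<le> norm (f t) * \<epsilon> + \<epsilon> * norm (g t)"
          by (intro add_mono mult_left_mono mult_right_mono GF) auto
        finally show "norm (f t * G y + F x * g t - ?k t) \<le> \<epsilon> * n t"
          by (simp add: algebra_simps n_def)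
      qed (use has_integral_integrable[OF hI] has_integral_integrable[OF has_integral_mult_right[OF nI, of \<epsilon>]] in simp_all)
      then show "norm (h y - h x) \<le> \<epsilon> * (V y - V x)"
        unfolding integral_unique[OF hI] integral_unique[OF has_integral_mult_right[OF nI, of \<epsilon>]] .
    qed (use d1 d2 in auto)
  qed (use x in auto)
  then have hconst: "h x = h 0" if "x \<in> {0..a}" for x using that by blast
  have "integral {0..x} ?k = F x * G x - F 0 * G 0" if "x \<in> {0..a}" for x
    using hconst[OF that] unfolding h_def by (simp add: algebra_simps)
  moreover have "primitive_on a (\<lambda>x. 0 + integral {0..x} ?k) ?k"
    by (rule primitive_on_of_integral[OF ak])
  ultimately show ?thesis
    unfolding primitive_on_def by simp
qed

lemma primitive_on_lincomb:
  assumes "primitive_on a F f" "primitive_on a G g"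
  shows "primitive_on a (\<lambda>x. c * F x + d * G x) (\<lambda>x. c * f x + d * g x)"
proof -
  have "((\<lambda>x. c * f x + d * g x) has_integral (c * F x + d * G x - (c * F 0 + d * G 0))) {0..x}"
    if "x \<in> {0..a}" for x
  proof -
    have "((\<lambda>x. c * f x + d * g x) has_integral (c * (F x - F 0) + d * (G x - G 0))) {0..x}"
      using assms that by (intro has_integral_add has_integral_mult_right) (auto simp: primitive_on_def)
    then show ?thesis by (simp add: algebra_simps)
  qed
  moreover have "(\<lambda>x. c * f x + d * g x) absolutely_integrable_on {0..a}"
    using assms set_integral_add(1)[OF absolutely_integrable_mult_continuous[where f=f and g="\<lambda>_. c"]
      absolutely_integrable_mult_continuous[where f=g and g="\<lambda>_. d"]]
    by (simp add: primitive_on_def mult.commute)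
  ultimately show ?thesis by (auto simp: primitive_on_def)
qed

lemma primitive_on_cong:
  assumes F: "primitive_on a F f" and eqF: "\<And>x. x \<in> {0..a} \<Longrightarrow> F x = F' x"
    and eqf: "\<And>x. x \<in> {0..a} \<Longrightarrow> f x = f' x"
  shows "primitive_on a F' f'"
  unfolding primitive_on_def
proof (intro conjI ballI)
  have "f absolutely_integrable_on {0..a}" using F by (simp add: primitive_on_def)
  then show "f' absolutely_integrable_on {0..a}"
    by (rule absolutely_integrable_spike[OF _ negligible_empty]) (simp add: eqf)
next
  fix x assume x: "x \<in> {0..a}"
  have "(f has_integral F x - F 0) {0..x}" using F x unfolding primitive_on_def by blast
  moreover have "f y = f' y" if "y \<in> {0..x}" for y using eqf x that by simp
  ultimately have "(f' has_integral F x - F 0) {0..x}"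
    using has_integral_eq by blast
  moreover have "F x = F' x" "F 0 = F' 0" using eqF x by auto
  ultimately show "(f' has_integral F' x - F' 0) {0..x}" by metis
qed

lemma primitive_on_C1:
  assumes d: "\<And>x. x \<in> {0..a} \<Longrightarrow> (F has_vector_derivative f x) (at x within {0..a})"
    and c: "continuous_on {0..a} f"
  shows "primitive_on a F f"
  unfolding primitive_on_def
proof (intro conjI ballI)
  show "f absolutely_integrable_on {0..a}" by (rule absolutely_integrable_continuous_real[OF c])
next
  fix x assume x: "x \<in> {0..a}"
  show "(f has_integral (F x - F 0)) {0..x}"
  proof (rule fundamental_theorem_of_calculus)
    fix y assume y: "y \<in> {0..x}"
    show "(F has_vector_derivative f y) (at y within {0..x})"
      by (rule has_vector_derivative_within_subset[of _ _ _ "{0..a}"], rule d) (use x y in auto)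
  qed (use x in auto)
qed

lemma primitive_on_has_vector_derivative:
  assumes F: "primitive_on a F f" and c: "continuous_on {0..a} f" and x: "x \<in> {0..a}"
  shows "(F has_vector_derivative f x) (at x within {0..a})"
proof -
  have "((\<lambda>x. integral {0..x} f) has_vector_derivative f x) (at x within {0..a})"
    by (rule integral_has_vector_derivative[OF c x])
  then have "((\<lambda>x. F 0 + integral {0..x} f) has_vector_derivative (0 + f x)) (at x within {0..a})"
    by (intro has_vector_derivative_add has_vector_derivative_const)
  moreover have "F y = F 0 + integral {0..y} f" if "y \<in> {0..a}" for y
  proof -
    have "integral {0..y} f = F y - F 0"
      using F that by (intro integral_unique) (auto simp: primitive_on_def)
    then show ?thesis by simp
  qed
  ultimately show ?thesis
    using has_vector_derivative_transform[OF x, of F "\<lambda>x. F 0 + integral {0..x} f"]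
    by (metis add_0)
qed

lemma AE_lebesgue_on_negligible:
  fixes a :: real
  assumes "AE x in lebesgue_on {0<..<a}. P x"
  obtains N where "negligible N" "\<And>x. x \<in> {0..a} - N \<Longrightarrow> P x"
proof -
  have "AE x in lebesgue. x \<in> {0<..<a} \<longrightarrow> P x"
    using assms by (simp add: AE_restrict_space_iff)
  then obtain M where M: "{x \<in> space lebesgue. \<not> (x \<in> {0<..<a} \<longrightarrow> P x)} \<subseteq> M" "emeasure lebesgue M = 0" "M \<in> sets lebesgue"
    by (rule AE_E)
  have "negligible M" using M by (simp add: negligible_iff_null_sets null_sets_def)
  then have "negligible (M \<union> {0, a})" by (intro negligible_Un) auto
  moreover have "P x" if x: "x \<in> {0..a} - (M \<union> {0, a})" for x
  proof -
    have "x \<in> {0<..<a}" "x \<notin> M" using x by auto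
    then show ?thesis using M(1) by auto
  qed
  ultimately show ?thesis using that by blast
qed

lemma primitive_on_spike:
  assumes F: "primitive_on a F f" and N: "negligible N" and eq: "\<And>x. x \<in> {0..a} - N \<Longrightarrow> g x = f x"
  shows "primitive_on a F g"
  unfolding primitive_on_def
proof (intro conjI ballI)
  have "f absolutely_integrable_on {0..a}" using F by (simp add: primitive_on_def)
  then show "g absolutely_integrable_on {0..a}"
    by (rule absolutely_integrable_spike[OF _ N]) (rule eq)
  fix x assume x: "x \<in> {0..a}"
  have "(f has_integral F x - F 0) {0..x}" using F x unfolding primitive_on_def by blast
  then show "(g has_integral F x - F 0) {0..x}"
    by (rule has_integral_spike[OF N, rotated]) (use eq x in auto)
qed

section \<open>Solutions of the Schroedinger equation with integrable potential\<close>

text \<open>The equation \<open>u'' = p u\<close> as a first order system with \<open>v = u'\<close>; the spectral parameter is absorbed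
  in the potential \<open>p\<close>.\<close>

definition schroedinger_solution ::
  "real \<Rightarrow> (real \<Rightarrow> complex) \<Rightarrow> (real \<Rightarrow> complex) \<Rightarrow> (real \<Rightarrow> complex) \<Rightarrow> bool" where
  "schroedinger_solution a p u v \<longleftrightarrow> primitive_on a u v \<and> primitive_on a v (\<lambda>x. p x * u x)"

lemma schroedinger_continuous:
  assumes "schroedinger_solution a p u v"
  shows "continuous_on {0..a} u" "continuous_on {0..a} v"
  using assms primitive_on_continuous by (auto simp: schroedinger_solution_def)

lemma schroedinger_lincomb:
  assumes "schroedinger_solution a p u v" "schroedinger_solution a p w y"
  shows "schroedinger_solution a p (\<lambda>x. c * u x + d * w x) (\<lambda>x. c * v x + d * y x)"
  unfolding schroedinger_solution_def
proof
  show "primitive_on a (\<lambda>x. c * u x + d * w x) (\<lambda>x. c * v x + d * y x)"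
    using assms by (intro primitive_on_lincomb) (auto simp: schroedinger_solution_def)
  have "primitive_on a (\<lambda>x. c * v x + d * y x) (\<lambda>x. c * (p x * u x) + d * (p x * w x))"
    using assms by (intro primitive_on_lincomb) (auto simp: schroedinger_solution_def)
  then show "primitive_on a (\<lambda>x. c * v x + d * y x) (\<lambda>x. p x * (c * u x + d * w x))"
    by (rule primitive_on_cong) (auto simp: algebra_simps)
qed

text \<open>Lagrange's identity. Equal potentials make the Wronskian constant; potentials \<open>q - z\<close> and \<open>q - w\<close>
  compare solutions for different spectral parameters.\<close>

lemma primitive_on_wronskian:
  assumes "schroedinger_solution a p u v" "schroedinger_solution a r w y"
  shows "primitive_on a (\<lambda>x. u x * y x - v x * w x) (\<lambda>x. (r x - p x) * (u x * w x))"
proof -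
  have 1: "primitive_on a (\<lambda>x. u x * y x) (\<lambda>x. v x * y x + u x * (r x * w x))"
    using assms by (intro primitive_on_mult) (auto simp: schroedinger_solution_def)
  have 2: "primitive_on a (\<lambda>x. v x * w x) (\<lambda>x. (p x * u x) * w x + v x * y x)"
    using assms by (intro primitive_on_mult) (auto simp: schroedinger_solution_def)
  show ?thesis
    by (rule primitive_on_cong[OF primitive_on_lincomb[OF 1 2, of 1 "-1"]]) (auto simp: algebra_simps)
qed

lemma primitive_on_zero_imp_constant:
  assumes F: "primitive_on a F f" and z: "\<And>x. x \<in> {0..a} \<Longrightarrow> f x = 0" and x: "x \<in> {0..a}"
  shows "F x = F 0"
proof -
  have "(f has_integral (F x - F 0)) {0..x}" using F x by (simp add: primitive_on_def)
  moreover have "(f has_integral 0) {0..x}"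
    by (rule has_integral_is_0) (use z x in simp)
  ultimately have "F x - F 0 = 0" by (rule has_integral_unique)
  then show ?thesis by simp
qed

lemma wronskian_constant:
  assumes "schroedinger_solution a p u v" "schroedinger_solution a p w y" "x \<in> {0..a}"
  shows "u x * y x - v x * w x = u 0 * y 0 - v 0 * w 0"
  using primitive_on_zero_imp_constant[OF primitive_on_wronskian[OF assms(1,2)] _ assms(3)] by simp

text \<open>The Volterra equation \<open>u(x) = c + d x + \<integral>\<^sub>0\<^sup>x (x - t) p(t) u(t) dt\<close> is solved by a contraction. In the
  weighted unknown \<open>w(x) = e\<^bsup>-N x\<^esup> u(x)\<close> the kernel becomes \<open>(x - t) e\<^bsup>-N (x - t)\<^esup> p(t)\<close>, whose first factor
  is at most \<open>1/N\<close>; with \<open>Q\<close> the \<open>L\<^sup>1\<close> norm of \<open>p\<close> and \<open>N = 2 Q + 1\<close> the map contracts by the factor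
  \<open>1/2\<close> on the whole interval at once. The integral is written as \<open>x A(x) - B(x)\<close> with \<open>A\<close>, \<open>B\<close> the primitives
  of \<open>p u\<close> and \<open>t p u\<close>; this shows its continuity and later its derivative \<open>A\<close>.\<close>

lemma schroedinger_solution_exists:
  fixes c d :: complex
  assumes p: "p absolutely_integrable_on {0..a}" and a: "a \<ge> 0"
  shows "\<exists>u v. schroedinger_solution a p u v \<and> u 0 = c \<and> v 0 = d"
proof -
  define Q where "Q = integral {0..a} (\<lambda>t. norm (p t))"
  have pint: "(\<lambda>t. norm (p t)) integrable_on {0..a}"
    using p by (simp add: absolutely_integrable_on_def)
  have Q0: "Q \<ge> 0" unfolding Q_def by (intro integral_nonneg pint) auto
  define N where "N = 2 * Q + 1"
  have N: "N > 0" "Q / N \<le> 1/2" using Q0 by (auto simp: N_def field_simps)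
  define E where "E t = complex_of_real (exp (N * t))" for t
  have contE: "continuous_on S E" for S unfolding E_def by (intro continuous_intros)
  define k where "k w t = p t * (E t * w t)" for w :: "real \<Rightarrow> complex" and t
  define l where "l w t = p t * (of_real t * (E t * w t))" for w :: "real \<Rightarrow> complex" and t
  have abs_k: "k w absolutely_integrable_on {0..a}" and abs_l: "l w absolutely_integrable_on {0..a}"
    if "continuous_on {0..a} w" for w
    unfolding k_def l_def
    by (intro absolutely_integrable_mult_continuous[OF p] continuous_intros that contE)+
  define A where "A w y = 0 + integral {0..y} (k w)" for w y
  define B where "B w y = 0 + integral {0..y} (l w)" for w y
  have primA: "primitive_on a (A w) (k w)" and primB: "primitive_on a (B w) (l w)"
    if "continuous_on {0..a} w" for w
    unfolding A_def B_def by (intro primitive_on_of_integral abs_k abs_l that)+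
  have contA: "continuous_on {0..a} (A w)" and contB: "continuous_on {0..a} (B w)"
    if "continuous_on {0..a} w" for w
    using primitive_on_continuous primA[OF that] primB[OF that] by auto
  define F where "F w y = of_real (exp (- (N * y))) * (c + d * of_real y + (of_real y * A w y - B w y))" for w y
  have contF: "continuous_on {0..a} (F w)" if "continuous_on {0..a} w" for w
    unfolding F_def by (intro continuous_intros contA contB that)
  \<comment> \<open>Continuous functions on the interval are modelled by bounded continuous functions on the line,
    read off through the retraction onto the interval.\<close>
  define cl where "cl x = max 0 (min x a)" for x :: real
  have cl: "cl x \<in> {0..a}" for x using a by (auto simp: cl_def)
  have clid: "cl x = x" if "x \<in> {0..a}" for x using that by (auto simp: cl_def)
  define T where "T f = Bcontfun (\<lambda>x. F (apply_bcontfun f) (cl x))" for f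
  have T: "apply_bcontfun (T f) = (\<lambda>x. F (apply_bcontfun f) (cl x))" for f
  proof -
    have cf: "continuous_on {0..a} (F (apply_bcontfun f))" by (intro contF) simp
    have "continuous_on UNIV cl" unfolding cl_def by (intro continuous_intros)
    then have "continuous_on UNIV (\<lambda>x. F (apply_bcontfun f) (cl x))"
      by (rule continuous_on_compose2[OF cf]) (use cl in auto)
    moreover have "bounded (F (apply_bcontfun f) ` {0..a})"
      by (intro compact_imp_bounded compact_continuous_image cf) auto
    then have "bounded (range (\<lambda>x. F (apply_bcontfun f) (cl x)))"
      by (rule bounded_subset) (use cl in auto)
    ultimately show ?thesis unfolding T_def by (intro Bcontfun_inverse) (auto simp: bcontfun_def)
  qed
  have contr: "dist (T f) (T g) \<le> 1/2 * dist f g" for f g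
  proof (rule dist_bound)
    fix x
    define y where "y = cl x"
    have y: "y \<in> {0..a}" unfolding y_def by (rule cl)
    let ?f = "apply_bcontfun f" and ?g = "apply_bcontfun g"
    have fI: "(k ?f has_integral A ?f y) {0..y}" "(l ?f has_integral B ?f y) {0..y}"
      and gI: "(k ?g has_integral A ?g y) {0..y}" "(l ?g has_integral B ?g y) {0..y}"
      using primA[of ?f] primB[of ?f] primA[of ?g] primB[of ?g] y
      by (auto simp: primitive_on_def A_def B_def)
    define m where "m t = of_real (exp (- (N * y))) * (of_real y * (k ?f t - k ?g t) - (l ?f t - l ?g t))" for t
    have "(m has_integral of_real (exp (- (N * y))) * (of_real y * (A ?f y - A ?g y) - (B ?f y - B ?g y))) {0..y}"
      unfolding m_def
      by (intro has_integral_mult_right has_integral_diff fI gI)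
    moreover have "of_real (exp (- (N * y))) * (of_real y * (A ?f y - A ?g y) - (B ?f y - B ?g y)) = F ?f y - F ?g y"
      unfolding F_def by (simp add: algebra_simps)
    ultimately have mI: "(m has_integral (F ?f y - F ?g y)) {0..y}" by simp
    have py: "(\<lambda>t. norm (p t)) integrable_on {0..y}"
      by (rule integrable_subinterval_real[OF pint]) (use y in simp)
    have "norm (integral {0..y} m) \<le> integral {0..y} (\<lambda>t. (dist f g / N) * norm (p t))"
    proof (rule integral_norm_bound_integral)
      fix t assume t: "t \<in> {0..y}"
      have "m t = p t * (?f t - ?g t) * of_real ((y - t) * (exp (- (N * y)) * exp (N * t)))"
        unfolding m_def k_def l_def E_def by (simp add: algebra_simps)
      moreover have "exp (- (N * y)) * exp (N * t) = exp (- (N * (y - t)))"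
        by (simp add: exp_add[symmetric] algebra_simps)
      ultimately have "norm (m t) = norm (p t) * dist (?f t) (?g t) * ((y - t) * exp (- (N * (y - t))))"
        using t by (simp add: norm_mult dist_norm abs_mult del: of_real_mult of_real_diff)
      also have "\<dots> \<le> norm (p t) * dist f g * (1 / N)"
      proof (intro mult_mono)
        show "dist (?f t) (?g t) \<le> dist f g" by (rule dist_bounded)
        have "N * (y - t) \<le> exp (N * (y - t))"
          using exp_ge_add_one_self[of "N * (y - t)"] by linarith
        then have "N * (y - t) * exp (- (N * (y - t))) \<le> exp (N * (y - t)) * exp (- (N * (y - t)))"
          by (intro mult_right_mono) auto
        then have "N * ((y - t) * exp (- (N * (y - t)))) \<le> 1"
          by (simp add: exp_minus mult.assoc)
        then show "(y - t) * exp (- (N * (y - t))) \<le> 1 / N"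
          using N(1) by (simp add: pos_le_divide_eq mult.commute)
      qed (use t in auto)
      finally show "norm (m t) \<le> (dist f g / N) * norm (p t)" by (simp add: algebra_simps)
    qed (use has_integral_integrable[OF mI] integrable_on_cmult_left[OF py, of "dist f g / N"] in simp_all)
    also have "\<dots> = (dist f g / N) * integral {0..y} (\<lambda>t. norm (p t))" by simp
    also have "\<dots> \<le> (dist f g / N) * Q"
      unfolding Q_def using N y by (intro mult_left_mono integral_subset_le py pint) auto
    also have "\<dots> = dist f g * (Q / N)" by simp
    also have "\<dots> \<le> dist f g * (1/2)" using N by (intro mult_left_mono) auto
    finally show "dist (apply_bcontfun (T f) x) (apply_bcontfun (T g) x) \<le> 1/2 * dist f g"
      using integral_unique[OF mI] by (simp add: T y_def[symmetric] dist_norm)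
  qed
  obtain f where f: "T f = f"
    using banach_fix_type[of "1/2" T] contr by auto
  define w where "w = apply_bcontfun f"
  have contw: "continuous_on {0..a} w" by (simp add: w_def)
  have wF: "w x = F w x" if "x \<in> {0..a}" for x
    using T[of f] f clid[OF that] unfolding w_def by metis
  define u where "u x = E x * w x" for x
  define v where "v x = d + A w x" for x
  have ueq: "u x = c + d * of_real x + (of_real x * A w x - B w x)" if "x \<in> {0..a}" for x
  proof -
    have "E x * of_real (exp (- (N * x))) = 1"
      by (simp add: E_def of_real_mult[symmetric] exp_add[symmetric] del: of_real_mult)
    then show ?thesis unfolding u_def wF[OF that] F_def by (simp add: mult.assoc[symmetric])
  qed
  have ku: "k w = (\<lambda>x. p x * u x)" by (auto simp: k_def u_def)
  have v: "primitive_on a v (\<lambda>x. p x * u x)"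
    using primitive_on_of_integral[OF abs_k[OF contw], of d] unfolding v_def A_def ku by simp
  have id: "primitive_on a (\<lambda>x. of_real x) (\<lambda>x. 1)"
    by (rule primitive_on_C1) (auto intro!: derivative_eq_intros)
  have lin: "primitive_on a (\<lambda>x. c + d * of_real x) (\<lambda>x. d)"
    by (rule primitive_on_C1) (auto intro!: derivative_eq_intros)
  have "primitive_on a (\<lambda>x. of_real x * A w x) (\<lambda>x. 1 * A w x + of_real x * k w x)"
    by (rule primitive_on_mult[OF id primA[OF contw]])
  from primitive_on_lincomb[OF this primB[OF contw], of 1 "-1"]
  have "primitive_on a (\<lambda>x. of_real x * A w x - B w x) (A w)"
    by (rule primitive_on_cong) (auto simp: k_def l_def)
  from primitive_on_lincomb[OF lin this, of 1 1]
  have "primitive_on a u v"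
    by (rule primitive_on_cong) (auto simp: ueq v_def)
  moreover have "u 0 = c" "v 0 = d"
    using ueq[of 0] a by (auto simp: B_def v_def A_def)
  ultimately show ?thesis using v unfolding schroedinger_solution_def by blast
qed

text \<open>A solution \<open>h\<close> with zero data has vanishing Wronskian with both members of a fundamental system
  \<open>C\<close>, \<open>S\<close>, and \<open>h\<close> is a combination of these Wronskians because \<open>C S' - C' S = 1\<close>.\<close>

lemma schroedinger_unique:
  assumes p: "p absolutely_integrable_on {0..a}"
    and s: "schroedinger_solution a p u v" "schroedinger_solution a p w y"
    and i: "u 0 = w 0" "v 0 = y 0" and x: "x \<in> {0..a}"
  shows "u x = w x" "v x = y x"
proof -
  have a: "a \<ge> 0" using x by auto
  obtain C C' where C: "schroedinger_solution a p C C'" "C 0 = 1" "C' 0 = 0"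
    using schroedinger_solution_exists[OF p a] by blast
  obtain S S' where S: "schroedinger_solution a p S S'" "S 0 = 0" "S' 0 = 1"
    using schroedinger_solution_exists[OF p a] by blast
  define h where "h x = 1 * u x + (-1) * w x" for x
  define h' where "h' x = 1 * v x + (-1) * y x" for x
  have h: "schroedinger_solution a p h h'"
    unfolding h_def h'_def by (rule schroedinger_lincomb[OF s])
  have h0: "h 0 = 0" "h' 0 = 0" using i by (auto simp: h_def h'_def)
  have 1: "C x * S' x - C' x * S x = 1"
    using wronskian_constant[OF C(1) S(1) x] C S by simp
  have 2: "h x * S' x - h' x * S x = 0" "h x * C' x - h' x * C x = 0"
    using wronskian_constant[OF h S(1) x] wronskian_constant[OF h C(1) x] h0 by auto
  have "h x = h x * (C x * S' x - C' x * S x)" using 1 by simp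
  also have "\<dots> = C x * (h x * S' x - h' x * S x) - S x * (h x * C' x - h' x * C x)"
    by (simp add: algebra_simps)
  finally show "u x = w x" using 2 by (simp add: h_def)
  have "h' x = h' x * (C x * S' x - C' x * S x)" using 1 by simp
  also have "\<dots> = C' x * (h x * S' x - h' x * S x) - S' x * (h x * C' x - h' x * C x)"
    by (simp add: algebra_simps)
  finally show "v x = y x" using 2 by (simp add: h'_def)
qed

lemma has_integral_reflect_interval:
  fixes f :: "real \<Rightarrow> 'a::euclidean_space"
  assumes "(f has_integral i) {a - y..a - x}"
  shows "((\<lambda>t. f (a - t)) has_integral i) {x..y}"
proof -
  have "(f has_integral i) (cbox (a - y) (a - x))" using assms by simp
  from has_integral_affinity[OF this, of "-1" a]
  have "((\<lambda>t. f (- t + a)) has_integral i) ((\<lambda>x. a - x) ` {a - y..a - x})" by simp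
  then show ?thesis by (simp add: image_diff_atLeastAtMost)
qed

lemma absolutely_integrable_reflect_interval:
  fixes f :: "real \<Rightarrow> complex"
  assumes "f absolutely_integrable_on {0..a}"
  shows "(\<lambda>t. f (a - t)) absolutely_integrable_on {0..a}"
proof -
  obtain i j where "(f has_integral i) {0..a}" "((\<lambda>t. norm (f t)) has_integral j) {0..a}"
    using assms by (auto simp: absolutely_integrable_on_def integrable_on_def)
  then show ?thesis
    using has_integral_reflect_interval[of f i a a 0] has_integral_reflect_interval[of "\<lambda>t. norm (f t)" j a a 0]
    by (auto simp: absolutely_integrable_on_def integrable_on_def)
qed

lemma primitive_on_reflect:
  assumes F: "primitive_on a F f"
  shows "primitive_on a (\<lambda>x. F (a - x)) (\<lambda>x. - f (a - x))"
  unfolding primitive_on_def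
proof (intro conjI ballI)
  have "f absolutely_integrable_on {0..a}" using F by (simp add: primitive_on_def)
  then show "(\<lambda>x. - f (a - x)) absolutely_integrable_on {0..a}"
    using absolutely_integrable_reflect_interval[of a f]
      absolutely_integrable_mult_continuous[where u=0 and v=a and f="\<lambda>x. f (a - x)" and g="\<lambda>_. -1"] by simp
  fix x assume x: "x \<in> {0..a}"
  have "(f has_integral (F a - F (a - x))) {a - x..a - 0}"
    using primitive_on_has_integral[OF F, of "a - x" a] x by simp
  from has_integral_neg[OF has_integral_reflect_interval[OF this]]
  show "((\<lambda>x. - f (a - x)) has_integral F (a - x) - F (a - 0)) {0..x}" by simp
qed

lemma schroedinger_reflect:
  assumes s: "schroedinger_solution a p u v"
    and sym: "AE x in lebesgue_on {0<..<a}. p x = p (a - x)"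
  shows "schroedinger_solution a p (\<lambda>x. u (a - x)) (\<lambda>x. - v (a - x))"
proof -
  obtain N where N: "negligible N" "\<And>x. x \<in> {0..a} - N \<Longrightarrow> p x = p (a - x)"
    using AE_lebesgue_on_negligible[OF sym] by blast
  have 1: "primitive_on a (\<lambda>x. u (a - x)) (\<lambda>x. - v (a - x))"
    using s by (intro primitive_on_reflect) (simp add: schroedinger_solution_def)
  have "primitive_on a (\<lambda>x. v (a - x)) (\<lambda>x. - (p (a - x) * u (a - x)))"
    using primitive_on_reflect[of a v "\<lambda>x. p x * u x"] s by (simp add: schroedinger_solution_def)
  from primitive_on_lincomb[OF this this, of "-1" 0]
  have "primitive_on a (\<lambda>x. - v (a - x)) (\<lambda>x. p (a - x) * u (a - x))" by simp
  then have "primitive_on a (\<lambda>x. - v (a - x)) (\<lambda>x. p x * u (a - x))"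
    by (rule primitive_on_spike[OF _ N(1)]) (use N(2) in simp)
  with 1 show ?thesis by (simp add: schroedinger_solution_def)
qed

lemma absolutely_integrable_diff_const:
  fixes q :: "real \<Rightarrow> complex"
  assumes "q absolutely_integrable_on {0..a}"
  shows "(\<lambda>t. q t - z) absolutely_integrable_on {0..a}"
  using set_integral_diff(1)[OF assms, of "\<lambda>_. z"] by simp

text \<open>The solution with data \<open>(c,d)\<close> at \<open>0\<close> and its derivative. They are determined by the equation on
  \<open>[0,a]\<close> only, hence the choice operator.\<close>

definition ivp_value :: "real \<Rightarrow> (real \<Rightarrow> complex) \<Rightarrow> complex \<Rightarrow> complex \<Rightarrow> real \<Rightarrow> complex" where
  "ivp_value a p c d = fst (SOME w. schroedinger_solution a p (fst w) (snd w) \<and> fst w 0 = c \<and> snd w 0 = d)"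

definition ivp_deriv :: "real \<Rightarrow> (real \<Rightarrow> complex) \<Rightarrow> complex \<Rightarrow> complex \<Rightarrow> real \<Rightarrow> complex" where
  "ivp_deriv a p c d = snd (SOME w. schroedinger_solution a p (fst w) (snd w) \<and> fst w 0 = c \<and> snd w 0 = d)"

lemma ivp_solution:
  assumes "p absolutely_integrable_on {0..a}" "a \<ge> 0"
  shows "schroedinger_solution a p (ivp_value a p c d) (ivp_deriv a p c d)"
    "ivp_value a p c d 0 = c" "ivp_deriv a p c d 0 = d"
proof -
  let ?P = "\<lambda>w. schroedinger_solution a p (fst w) (snd w) \<and> fst w 0 = c \<and> snd w 0 = d"
  obtain u v where "?P (u, v)" using schroedinger_solution_exists[OF assms] by fastforce
  then have "?P (SOME w. ?P w)" by (rule someI)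
  then show "schroedinger_solution a p (ivp_value a p c d) (ivp_deriv a p c d)"
    "ivp_value a p c d 0 = c" "ivp_deriv a p c d 0 = d"
    by (simp_all add: ivp_value_def ivp_deriv_def)
qed

lemma ivp_eqI:
  assumes "p absolutely_integrable_on {0..a}" "schroedinger_solution a p u v" "u 0 = c" "v 0 = d" "x \<in> {0..a}"
  shows "u x = ivp_value a p c d x" "v x = ivp_deriv a p c d x"
proof -
  have "a \<ge> 0" using assms(5) by auto
  note i = ivp_solution[OF assms(1) this, of c d]
  show "u x = ivp_value a p c d x" "v x = ivp_deriv a p c d x"
    using schroedinger_unique[OF assms(1,2) i(1) _ _ assms(5)] i assms(3,4) by auto
qed

lemma ivp_lincomb:
  assumes p: "p absolutely_integrable_on {0..a}" and x: "x \<in> {0..a}"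
  shows "ivp_value a p (k * c + l * d) (k * c' + l * d') x = k * ivp_value a p c c' x + l * ivp_value a p d d' x"
    "ivp_deriv a p (k * c + l * d) (k * c' + l * d') x = k * ivp_deriv a p c c' x + l * ivp_deriv a p d d' x"
proof -
  have a: "a \<ge> 0" using x by auto
  note i = ivp_solution[OF p a]
  note s = schroedinger_lincomb[OF i(1) i(1), of k c c' l d d']
  show "ivp_value a p (k * c + l * d) (k * c' + l * d') x = k * ivp_value a p c c' x + l * ivp_value a p d d' x"
    "ivp_deriv a p (k * c + l * d) (k * c' + l * d') x = k * ivp_deriv a p c c' x + l * ivp_deriv a p d d' x"
    using ivp_eqI[OF p s _ _ x, of "k * c + l * d" "k * c' + l * d'"] i(2,3) by auto
qed

section \<open>The characteristic function in terms of initial value problems\<close>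

lemma L2_on_absolutely_integrable:
  assumes "L2_on a q"
  shows "q absolutely_integrable_on {0..a}"
proof -
  let ?M = "lebesgue_on {0<..<a}"
  have m: "q \<in> borel_measurable ?M" and i: "integrable ?M (\<lambda>x. (norm (q x))\<^sup>2)"
    using assms by (auto simp: L2_on_def)
  have "(\<lambda>x. 1::real) absolutely_integrable_on {0<..<a}"
    using absolutely_integrable_on_const[of "{0<..<a}" "1::real"] by simp
  then have "integrable ?M (\<lambda>x. 1::real)"
    by (simp add: integrable_restrict_space set_integrable_def)
  then have "integrable ?M (\<lambda>x. 1 + (norm (q x))\<^sup>2)" using i by simp
  then have "integrable ?M q"
  proof (rule Bochner_Integration.integrable_bound[OF _ m], intro AE_I2)
    fix x
    have "0 \<le> (norm (q x) - 1)\<^sup>2" by simp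
    then have "2 * norm (q x) \<le> 1 + (norm (q x))\<^sup>2" by (simp add: power2_diff)
    moreover have "norm (q x) \<ge> 0" by simp
    ultimately have "norm (q x) \<le> 1 + (norm (q x))\<^sup>2" by linarith
    then show "norm (q x) \<le> norm (1 + (norm (q x))\<^sup>2)" by simp
  qed
  then have "q absolutely_integrable_on {0<..<a}"
    by (simp add: integrable_restrict_space set_integrable_def)
  then show ?thesis
  proof (rule absolutely_integrable_spike_set_eq[THEN iffD1, rotated -1])
    show "negligible {x \<in> {0<..<a} - {0..a}. q x \<noteq> 0}"
      by (rule negligible_subset[of "{}"]) auto
    show "negligible {x \<in> {0..a} - {0<..<a}. q x \<noteq> 0}"
      by (rule negligible_subset[of "{0,a}"]) auto
  qed
qed

text \<open>The second derivative may be replaced by the right hand side of the equation, with which it agrees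
  almost everywhere; this fixes one representative.\<close>

lemma sl_solution_iff_schroedinger:
  assumes q: "q absolutely_integrable_on {0..a}"
  shows "sl_solution a q \<mu> y y' \<longleftrightarrow> schroedinger_solution a (\<lambda>x. q x - \<mu>\<^sup>2) y y'"
proof
  assume s: "schroedinger_solution a (\<lambda>x. q x - \<mu>\<^sup>2) y y'"
  have "(y has_vector_derivative y' x) (at x within {0..a})" if "x \<in> {0..a}" for x
    using primitive_on_has_vector_derivative schroedinger_continuous(2)[OF s] s that
    unfolding schroedinger_solution_def by blast
  moreover have "(\<lambda>x. (q x - \<mu>\<^sup>2) * y x) absolutely_integrable_on {0..a}"
    "\<forall>x\<in>{0..a}. ((\<lambda>x. (q x - \<mu>\<^sup>2) * y x) has_integral (y' x - y' 0)) {0..x}"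
    using s by (auto simp: schroedinger_solution_def primitive_on_def)
  moreover have "AE x in lebesgue_on {0<..<a}. - ((q x - \<mu>\<^sup>2) * y x) + q x * y x = \<mu>\<^sup>2 * y x"
    by (intro AE_I2) (simp add: algebra_simps)
  ultimately show "sl_solution a q \<mu> y y'"
    unfolding sl_solution_def by blast
next
  assume s: "sl_solution a q \<mu> y y'"
  then obtain y'' where y'': "y'' absolutely_integrable_on {0..a}"
      "\<forall>x\<in>{0..a}. (y'' has_integral (y' x - y' 0)) {0..x}"
      "AE x in lebesgue_on {0<..<a}. - y'' x + q x * y x = \<mu>\<^sup>2 * y x"
    unfolding sl_solution_def by blast
  have p: "primitive_on a y' y''" using y'' by (simp add: primitive_on_def)
  obtain N where N: "negligible N" "\<And>x. x \<in> {0..a} - N \<Longrightarrow> - y'' x + q x * y x = \<mu>\<^sup>2 * y x"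
    using AE_lebesgue_on_negligible[OF y''(3)] by blast
  have "primitive_on a y' (\<lambda>x. (q x - \<mu>\<^sup>2) * y x)"
  proof (rule primitive_on_spike[OF p N(1)])
    fix x assume "x \<in> {0..a} - N"
    then have "- y'' x + q x * y x = \<mu>\<^sup>2 * y x" by (rule N(2))
    then show "(q x - \<mu>\<^sup>2) * y x = y'' x" by algebra
  qed
  moreover have "primitive_on a y y'"
    by (rule primitive_on_C1[OF _ primitive_on_continuous[OF p]]) (use s in \<open>simp add: sl_solution_def\<close>)
  ultimately show "schroedinger_solution a (\<lambda>x. q x - \<mu>\<^sup>2) y y'"
    by (simp add: schroedinger_solution_def)
qed

lemma char_fun_eq:
  assumes q: "q absolutely_integrable_on {0..a}" and a: "a \<ge> 0"
  shows "char_fun a q \<alpha>\<^sub>0 \<beta>\<^sub>0 \<alpha> \<beta> \<mu> =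
    ivp_deriv a (\<lambda>x. q x - \<mu>\<^sup>2) 1 (\<i> * of_real \<alpha>\<^sub>0 * \<mu> + \<beta>\<^sub>0) a +
    (\<i> * of_real \<alpha> * \<mu> + \<beta>) * ivp_value a (\<lambda>x. q x - \<mu>\<^sup>2) 1 (\<i> * of_real \<alpha>\<^sub>0 * \<mu> + \<beta>\<^sub>0) a"
    (is "_ = ?V + _ * ?U")
proof -
  note p = absolutely_integrable_diff_const[OF q, of "\<mu>\<^sup>2"]
  have aa: "a \<in> {0..a}" using a by simp
  note i = ivp_solution[OF p a, of 1 "\<i> * of_real \<alpha>\<^sub>0 * \<mu> + \<beta>\<^sub>0"]
  show ?thesis
    unfolding char_fun_def sl_solution_iff_schroedinger[OF q]
  proof (rule the_equality)
    show "\<exists>y y'. schroedinger_solution a (\<lambda>x. q x - \<mu>\<^sup>2) y y' \<and>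
        y 0 = 1 \<and> y' 0 = \<i> * of_real \<alpha>\<^sub>0 * \<mu> + \<beta>\<^sub>0 \<and>
        ?V + (\<i> * of_real \<alpha> * \<mu> + \<beta>) * ?U = y' a + (\<i> * of_real \<alpha> * \<mu> + \<beta>) * y a"
      using i by blast
  next
    fix d assume "\<exists>y y'. schroedinger_solution a (\<lambda>x. q x - \<mu>\<^sup>2) y y' \<and>
        y 0 = 1 \<and> y' 0 = \<i> * of_real \<alpha>\<^sub>0 * \<mu> + \<beta>\<^sub>0 \<and>
        d = y' a + (\<i> * of_real \<alpha> * \<mu> + \<beta>) * y a"
    then obtain y y' where y: "schroedinger_solution a (\<lambda>x. q x - \<mu>\<^sup>2) y y'"
        "y 0 = 1" "y' 0 = \<i> * of_real \<alpha>\<^sub>0 * \<mu> + \<beta>\<^sub>0" "d = y' a + (\<i> * of_real \<alpha> * \<mu> + \<beta>) * y a"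
      by blast
    show "d = ?V + (\<i> * of_real \<alpha> * \<mu> + \<beta>) * ?U"
      using ivp_eqI[OF p y(1-3) aa] y(4) by simp
  qed
qed

section \<open>Analytic dependence on the spectral parameter\<close>

text \<open>Writing \<open>u\<close> for the solution at \<open>z\<close>, its Wronskians with the fundamental system at \<open>w\<close> are
  \<open>c + (z - w) I\<close> and \<open>- d + (z - w) K\<close> by Lagrange's identity, and \<open>u\<close> is recovered from them. So the
  difference quotient in the spectral parameter is an explicit integral of \<open>u\<close> itself, and
  analyticity follows from continuity alone.\<close>

lemma ivp_increment:
  fixes q :: "real \<Rightarrow> complex" and z w c d :: complex
  assumes q: "q absolutely_integrable_on {0..a}" and x: "x \<in> {0..a}"
  defines "u \<equiv> \<lambda>z. ivp_value a (\<lambda>t. q t - z) c d" and "v \<equiv> \<lambda>z. ivp_deriv a (\<lambda>t. q t - z) c d"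
    and "C \<equiv> ivp_value a (\<lambda>t. q t - w) 1 0" and "C' \<equiv> ivp_deriv a (\<lambda>t. q t - w) 1 0"
    and "S \<equiv> ivp_value a (\<lambda>t. q t - w) 0 1" and "S' \<equiv> ivp_deriv a (\<lambda>t. q t - w) 0 1"
  defines "I \<equiv> integral {0..x} (\<lambda>t. u z t * S t)" and "K \<equiv> integral {0..x} (\<lambda>t. u z t * C t)"
  shows "u z x - u w x = (C x * I - S x * K) * (z - w)" "v z x - v w x = (C' x * I - S' x * K) * (z - w)"
proof -
  have a: "a \<ge> 0" using x by auto
  note p = absolutely_integrable_diff_const[OF q]
  have iz: "schroedinger_solution a (\<lambda>t. q t - z) (u z) (v z)" "u z 0 = c" "v z 0 = d"
    using ivp_solution[OF p[of z] a, of c d] by (simp_all add: u_def v_def)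
  note iC = ivp_solution[OF p[of w] a, of 1 0, folded C_def C'_def]
  note iS = ivp_solution[OF p[of w] a, of 0 1, folded S_def S'_def]
  have uw: "u w x = c * C x + d * S x" "v w x = c * C' x + d * S' x"
    unfolding u_def v_def C_def C'_def S_def S'_def
    using ivp_lincomb[OF p[of w] x, of c 1 d 0 0 1] by simp_all
  have aux: "u z x * y' x - v z x * y x = u z 0 * y' 0 - v z 0 * y 0 + (z - w) * integral {0..x} (\<lambda>t. u z t * y t)"
    if "schroedinger_solution a (\<lambda>t. q t - w) y y'" for y y'
  proof -
    have "primitive_on a (\<lambda>x. u z x * y' x - v z x * y x) (\<lambda>x. (z - w) * (u z x * y x))"
      using primitive_on_wronskian[OF iz(1) that] by simp
    then have "((\<lambda>x. (z - w) * (u z x * y x)) has_integral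
       ((u z x * y' x - v z x * y x) - (u z 0 * y' 0 - v z 0 * y 0))) {0..x}"
      using x by (simp add: primitive_on_def)
    from integral_unique[OF this] show ?thesis by simp
  qed
  have W1: "C x * S' x - C' x * S x = 1"
    using wronskian_constant[OF iC(1) iS(1) x] iC iS by simp
  have WS: "u z x * S' x - v z x * S x = c + (z - w) * I"
    using aux[OF iS(1)] iS iz by (simp add: I_def)
  have WC: "u z x * C' x - v z x * C x = - d + (z - w) * K"
    using aux[OF iC(1)] iC iz by (simp add: K_def)
  have "u z x = u z x * (C x * S' x - C' x * S x)" using W1 by simp
  also have "\<dots> = C x * (u z x * S' x - v z x * S x) - S x * (u z x * C' x - v z x * C x)"
    by (simp add: algebra_simps)
  finally show "u z x - u w x = (C x * I - S x * K) * (z - w)"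
    unfolding WS WC uw by (simp add: algebra_simps)
  have "v z x = v z x * (C x * S' x - C' x * S x)" using W1 by simp
  also have "\<dots> = C' x * (u z x * S' x - v z x * S x) - S' x * (u z x * C' x - v z x * C x)"
    by (simp add: algebra_simps)
  finally show "v z x - v w x = (C' x * I - S' x * K) * (z - w)"
    unfolding WS WC uw by (simp add: algebra_simps)
qed

lemma isCont_if_lipschitz_at:
  fixes f :: "complex \<Rightarrow> complex"
  assumes r: "r > 0" and L: "\<And>z. norm (z - w) < r \<Longrightarrow> norm (f z - f w) \<le> L * norm (z - w)"
  shows "isCont f w"
proof -
  have "((\<lambda>z. L * norm (z - w)) \<longlongrightarrow> L * norm (w - w)) (at w)" by (intro tendsto_intros)
  then have "((\<lambda>z. L * norm (z - w)) \<longlongrightarrow> 0) (at w)" by simp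
  moreover have "\<forall>\<^sub>F z in at w. norm (f z - f w) \<le> L * norm (z - w)"
    unfolding eventually_at using r L by (auto simp: dist_norm)
  ultimately have "((\<lambda>z. f z - f w) \<longlongrightarrow> 0) (at w)" by (rule Lim_null_comparison[rotated])
  then show ?thesis unfolding isCont_def by (simp add: LIM_zero_iff)
qed

lemma continuous_on_norm_bound:
  fixes f :: "real \<Rightarrow> complex"
  assumes "continuous_on {0..a} f"
  obtains M where "M > 0" "\<And>x. x \<in> {0..a} \<Longrightarrow> norm (f x) \<le> M"
proof -
  have "bounded (f ` {0..a})" using assms by (intro compact_imp_bounded compact_continuous_image) auto
  then obtain M where "M > 0" "\<And>y. y \<in> f ` {0..a} \<Longrightarrow> norm y \<le> M" unfolding bounded_pos by auto
  then show ?thesis using that by auto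
qed

lemma integral_product_bound:
  fixes f g :: "real \<Rightarrow> complex"
  assumes f: "continuous_on {0..a} f" "\<And>t. t \<in> {0..a} \<Longrightarrow> norm (f t) \<le> A" 
    and g: "continuous_on {0..a} g" "\<And>t. t \<in> {0..a} \<Longrightarrow> norm (g t) \<le> B" and x: "x \<in> {0..a}"
  shows "norm (integral {0..x} (\<lambda>t. f t * g t)) \<le> a * (A * B)"
proof -
  have "0 \<in> {0..a}" using x by auto
  then have AB: "A \<ge> 0" "B \<ge> 0" using f(2) g(2) norm_ge_zero order_trans by blast+
  have "norm (integral {0..x} (\<lambda>t. f t * g t)) \<le> A * B * (x - 0)"
  proof (rule integral_bound)
    show "continuous_on {0..x} (\<lambda>t. f t * g t)"
      by (rule continuous_on_subset[of "{0..a}"], intro continuous_intros f g) (use x in auto)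
    fix t assume t: "t \<in> {0..x}"
    show "norm (f t * g t) \<le> A * B"
      unfolding norm_mult by (intro mult_mono f g) (use x t AB in auto)
  qed (use x in auto)
  also have "\<dots> \<le> A * B * a" using x AB by (intro mult_left_mono) auto
  finally show ?thesis by (simp add: mult.commute)
qed

text \<open>By the increment formula the difference quotient extends continuously to \<open>z = w\<close> as soon as \<open>u\<^sub>z\<close>
  tends to \<open>u\<^sub>w\<close> uniformly on \<open>[0,a]\<close>. The formula also provides this: it bounds the maximum of
  \<open>|u\<^sub>z|\<close> by the maximum of \<open>|u\<^sub>w|\<close> plus a small multiple of itself when \<open>z\<close> is near \<open>w\<close>.\<close>

theorem ivp_holomorphic:
  fixes q :: "real \<Rightarrow> complex"
  assumes q: "q absolutely_integrable_on {0..a}" and x: "x \<in> {0..a}"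
  shows "(\<lambda>z. ivp_value a (\<lambda>t. q t - z) c d x) holomorphic_on UNIV"
    "(\<lambda>z. ivp_deriv a (\<lambda>t. q t - z) c d x) holomorphic_on UNIV"
proof -
  define u where "u = (\<lambda>z. ivp_value a (\<lambda>t. q t - z) c d)"
  define v where "v = (\<lambda>z. ivp_deriv a (\<lambda>t. q t - z) c d)"
  have a: "a \<ge> 0" using x by auto
  note p = absolutely_integrable_diff_const[OF q]
  have contu: "continuous_on {0..a} (u z)" for z
    using schroedinger_continuous(1)[OF ivp_solution(1)[OF p a]] by (simp add: u_def)
  have key: "(\<lambda>z. u z x) field_differentiable at w \<and> (\<lambda>z. v z x) field_differentiable at w" for w
  proof -
    define C C' S S' where "C = ivp_value a (\<lambda>t. q t - w) 1 0" and "C' = ivp_deriv a (\<lambda>t. q t - w) 1 0"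
      and "S = ivp_value a (\<lambda>t. q t - w) 0 1" and "S' = ivp_deriv a (\<lambda>t. q t - w) 0 1"
    have contCS: "continuous_on {0..a} C" "continuous_on {0..a} S"
      using schroedinger_continuous(1)[OF ivp_solution(1)[OF p a]] by (auto simp: C_def S_def)
    obtain MC where MC: "MC > 0" "\<And>y. y \<in> {0..a} \<Longrightarrow> norm (C y) \<le> MC"
      using continuous_on_norm_bound[OF contCS(1)] by blast
    obtain MS where MS: "MS > 0" "\<And>y. y \<in> {0..a} \<Longrightarrow> norm (S y) \<le> MS"
      using continuous_on_norm_bound[OF contCS(2)] by blast
    obtain m where m: "m > 0" "\<And>y. y \<in> {0..a} \<Longrightarrow> norm (u w y) \<le> m"
      using continuous_on_norm_bound[OF contu] by blast
    define I where "I y z = integral {0..y} (\<lambda>t. u z t * S t)" for y z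
    define K where "K y z = integral {0..y} (\<lambda>t. u z t * C t)" for y z
    have inc: "u z y - u w y = (C y * I y z - S y * K y z) * (z - w)"
      "v z y - v w y = (C' y * I y z - S' y * K y z) * (z - w)" if "y \<in> {0..a}" for y z
      using ivp_increment[OF q that, of z c d w]
      by (simp_all add: u_def v_def C_def C'_def S_def S'_def I_def K_def)
    define L where "L = 2 * a * MC * MS"
    have L0: "L \<ge> 0" using a MC MS by (simp add: L_def)
    have diff: "norm (u z y - u w y) \<le> L * n * norm (z - w)"
      if n: "\<And>t. t \<in> {0..a} \<Longrightarrow> norm (u z t) \<le> n" and y: "y \<in> {0..a}" for z n y
    proof -
      have "norm (C y * I y z - S y * K y z) \<le> norm (C y) * norm (I y z) + norm (S y) * norm (K y z)"
        by (metis norm_mult norm_triangle_ineq4)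
      also have "\<dots> \<le> MC * (a * (n * MS)) + MS * (a * (n * MC))"
        unfolding I_def K_def
        by (intro add_mono mult_mono MC MS integral_product_bound contu contCS n y)
           (use MC MS in auto)
      also have "\<dots> = L * n" by (simp add: L_def algebra_simps)
      finally show ?thesis
        unfolding inc(1)[OF y] norm_mult by (intro mult_right_mono) auto
    qed
    define r where "r = 1 / (2 * (L + 1))"
    have r0: "r > 0" using L0 by (simp add: r_def)
    have ubound: "norm (u z y) \<le> 2 * m" if z: "norm (z - w) < r" and y: "y \<in> {0..a}" for z y
    proof -
      have "continuous_on {0..a} (\<lambda>t. norm (u z t))" by (intro continuous_intros contu)
      then obtain t0 where t0: "t0 \<in> {0..a}" "\<And>t. t \<in> {0..a} \<Longrightarrow> norm (u z t) \<le> norm (u z t0)"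
        using continuous_attains_sup[of "{0..a}" "\<lambda>t. norm (u z t)"] y by auto
      define n where "n = norm (u z t0)"
      have "norm (u z t0 - u w t0) \<le> L * n * norm (z - w)"
        by (rule diff) (use t0 in \<open>auto simp: n_def\<close>)
      moreover have "L * n * norm (z - w) \<le> n / 2"
      proof -
        have "L * norm (z - w) \<le> (L + 1) * r"
          using z L0 by (intro mult_mono) auto
        also have "\<dots> = 1/2" using L0 by (simp add: r_def)
        finally have "n * (L * norm (z - w)) \<le> n * (1/2)"
          by (intro mult_left_mono) (auto simp: n_def)
        then show ?thesis by (simp add: mult_ac)
      qed
      moreover have "n \<le> norm (u z t0 - u w t0) + norm (u w t0)"
        unfolding n_def by (metis add.commute norm_triangle_sub)
      ultimately have "n \<le> 2 * m" using m(2)[OF t0(1)] by linarith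
      then show ?thesis using t0(2)[OF y] by (simp add: n_def)
    qed
    have udiff: "norm (u z y - u w y) \<le> L * (2 * m) * norm (z - w)"
      if "norm (z - w) < r" "y \<in> {0..a}" for z y
      by (rule diff) (use ubound that in auto)
    have contint: "isCont (\<lambda>z. integral {0..x} (\<lambda>t. u z t * g t)) w"
      if g: "continuous_on {0..a} g" "\<And>t. t \<in> {0..a} \<Longrightarrow> norm (g t) \<le> G" for g G
    proof (rule isCont_if_lipschitz_at[OF r0])
      fix z assume z: "norm (z - w) < r"
      have int: "(\<lambda>t. u z t * g t) integrable_on {0..x}" for z
      proof (rule integrable_continuous_real)
        have "continuous_on {0..a} (\<lambda>t. u z t * g t)" by (intro continuous_intros contu g)
        then show "continuous_on {0..x} (\<lambda>t. u z t * g t)"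
          by (rule continuous_on_subset) (use x in auto)
      qed
      have "integral {0..x} (\<lambda>t. u z t * g t) - integral {0..x} (\<lambda>t. u w t * g t)
          = integral {0..x} (\<lambda>t. (u z t - u w t) * g t)"
        using Henstock_Kurzweil_Integration.integral_diff[OF int[of z] int[of w]] by (simp add: algebra_simps)
      also have "norm \<dots> \<le> a * ((L * (2 * m) * norm (z - w)) * G)"
      proof (rule integral_product_bound)
        show "continuous_on {0..a} (\<lambda>t. u z t - u w t)" by (intro continuous_intros contu)
        show "norm (u z t - u w t) \<le> L * (2 * m) * norm (z - w)" if "t \<in> {0..a}" for t
          by (rule udiff[OF z that])
      qed (use g x in auto)
      finally show "norm (integral {0..x} (\<lambda>t. u z t * g t) - integral {0..x} (\<lambda>t. u w t * g t))
          \<le> (a * (L * (2 * m)) * G) * norm (z - w)" by (simp add: mult_ac)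
    qed
    have cI: "isCont (I x) w" and cK: "isCont (K x) w"
      unfolding I_def K_def using contint contCS MC(2) MS(2) by blast+
    have "((\<lambda>z. u z x) has_field_derivative (C x * I x w - S x * K x w)) (at w)"
      unfolding DERIV_caratheodory_within
      by (rule exI[of _ "\<lambda>z. C x * I x z - S x * K x z"])
         (auto simp: inc(1)[OF x] intro!: continuous_intros cI cK)
    moreover have "((\<lambda>z. v z x) has_field_derivative (C' x * I x w - S' x * K x w)) (at w)"
      unfolding DERIV_caratheodory_within
      by (rule exI[of _ "\<lambda>z. C' x * I x z - S' x * K x z"])
         (auto simp: inc(2)[OF x] intro!: continuous_intros cI cK)
    ultimately show ?thesis unfolding field_differentiable_def by blast
  qed
  show "(\<lambda>z. ivp_value a (\<lambda>t. q t - z) c d x) holomorphic_on UNIV"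
    "(\<lambda>z. ivp_deriv a (\<lambda>t. q t - z) c d x) holomorphic_on UNIV"
    using key by (simp_all add: holomorphic_on_def u_def v_def)
qed

section \<open>Asymptotics for large spectral parameter\<close>

lemma norm_sin_cos_le_exp_Im:
  assumes "r \<ge> 0"
  shows "norm (sin (l * of_real r)) \<le> exp (\<bar>Im l\<bar> * r)" "norm (cos (l * of_real r)) \<le> exp (\<bar>Im l\<bar> * r)"
proof -
  have b: "norm (exp (\<i> * (l * of_real r))) \<le> exp (\<bar>Im l\<bar> * r)"
    "norm (exp (- (\<i> * (l * of_real r)))) \<le> exp (\<bar>Im l\<bar> * r)"
    using mult_right_mono[of "Im l" "\<bar>Im l\<bar>" r] mult_right_mono[of "- Im l" "\<bar>Im l\<bar>" r] assms
    by (simp_all add: norm_exp_eq_Re)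
  have "norm (exp (\<i> * (l * of_real r)) - exp (- (\<i> * (l * of_real r)))) \<le> 2 * exp (\<bar>Im l\<bar> * r)"
    by (rule order_trans[OF norm_triangle_ineq4]) (use b in linarith)
  then show "norm (sin (l * of_real r)) \<le> exp (\<bar>Im l\<bar> * r)"
    by (simp add: sin_exp_eq norm_divide norm_mult)
  have "norm (exp (\<i> * (l * of_real r)) + exp (- (\<i> * (l * of_real r)))) \<le> 2 * exp (\<bar>Im l\<bar> * r)"
    by (rule order_trans[OF norm_triangle_ineq]) (use b in linarith)
  then show "norm (cos (l * of_real r)) \<le> exp (\<bar>Im l\<bar> * r)"
    by (simp add: cos_exp_eq norm_divide norm_mult)
qed

text \<open>Variation of constants with respect to \<open>sin\<close> and \<open>cos\<close> gives
  \<open>l u(x) = v(0) sin (l x) + l u(0) cos (l x) + \<integral>\<^sub>0\<^sup>x q(t) u(t) sin (l (x - t)) dt\<close>, and a similar formula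
  for \<open>v\<close>. Evaluated where \<open>|u(t)| e\<^bsup>-|Im l| t\<^esup>\<close> is maximal, the integral is at most \<open>Q\<close> times this
  maximum, hence at most half of the left hand side when \<open>2 Q \<le> |l|\<close>. This bounds \<open>u\<close>, and
  inserting the bound into the two formulas gives the error terms.\<close>

theorem schroedinger_asymptotics:
  fixes q :: "real \<Rightarrow> complex" and l :: complex
  assumes q: "q absolutely_integrable_on {0..a}" and s: "schroedinger_solution a (\<lambda>t. q t - l\<^sup>2) u v"
    and Q: "integral {0..a} (\<lambda>t. norm (q t)) \<le> Q" and l: "l \<noteq> 0" "2 * Q \<le> norm l" and x: "x \<in> {0..a}"
    and B: "norm (u 0) + norm (v 0) / norm l \<le> B"
  shows "norm (u x) \<le> 2 * B * exp (\<bar>Im l\<bar> * x)"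
    and "norm (l * u x - (v 0 * sin (l * of_real x) + l * u 0 * cos (l * of_real x))) \<le> 2 * B * Q * exp (\<bar>Im l\<bar> * x)"
    and "norm (v x - (v 0 * cos (l * of_real x) - l * u 0 * sin (l * of_real x))) \<le> 2 * B * Q * exp (\<bar>Im l\<bar> * x)"
proof -
  define \<tau> where "\<tau> = \<bar>Im l\<bar>"
  have a: "a \<ge> 0" using x by auto
  have qint: "(\<lambda>t. norm (q t)) integrable_on {0..a}" using q by (simp add: absolutely_integrable_on_def)
  have pu: "primitive_on a u v" and pv: "primitive_on a v (\<lambda>t. (q t - l\<^sup>2) * u t)"
    using s by (auto simp: schroedinger_solution_def)
  have rep: "((\<lambda>t. q t * u t * sin (l * of_real (y - t))) has_integral
        (l * u y - (v 0 * sin (l * of_real y) + l * u 0 * cos (l * of_real y)))) {0..y}"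
     "((\<lambda>t. q t * u t * cos (l * of_real (y - t))) has_integral
        (v y - (v 0 * cos (l * of_real y) - l * u 0 * sin (l * of_real y)))) {0..y}"
    if y: "y \<in> {0..a}" for y
  proof -
    define sn where "sn t = sin (l * of_real (y - t))" for t
    define cs where "cs t = cos (l * of_real (y - t))" for t
    have csn: "continuous_on A sn" "continuous_on A cs" for A
      unfolding sn_def cs_def by (intro continuous_intros)+
    have ds: "(sn has_vector_derivative (- l * cs t)) (at t within {0..a})" for t
    proof -
      have "((\<lambda>z. sin (l * (of_real y - z))) has_field_derivative (- l * cs t)) (at (of_real t))"
        by (auto intro!: derivative_eq_intros simp: cs_def)
      from has_vector_derivative_real_field[OF this] show ?thesis by (simp add: sn_def[abs_def])
    qed
    have dc: "(cs has_vector_derivative (l * sn t)) (at t within {0..a})" for t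
    proof -
      have "((\<lambda>z. cos (l * (of_real y - z))) has_field_derivative (l * sn t)) (at (of_real t))"
        by (auto intro!: derivative_eq_intros simp: sn_def)
      from has_vector_derivative_real_field[OF this] show ?thesis by (simp add: cs_def[abs_def])
    qed
    have ps: "primitive_on a sn (\<lambda>t. - l * cs t)"
      by (rule primitive_on_C1[OF ds]) (intro continuous_intros csn)
    have pc: "primitive_on a cs (\<lambda>t. l * sn t)"
      by (rule primitive_on_C1[OF dc]) (intro continuous_intros csn)
    have "primitive_on a (\<lambda>t. v t * sn t + l * (u t * cs t)) (\<lambda>t. q t * u t * sn t)"
      by (rule primitive_on_cong[OF primitive_on_lincomb[OF primitive_on_mult[OF pv ps] primitive_on_mult[OF pu pc], of 1 l]])
         (auto simp: algebra_simps power2_eq_square)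
    then have "((\<lambda>t. q t * u t * sn t) has_integral 
      ((v y * sn y + l * (u y * cs y)) - (v 0 * sn 0 + l * (u 0 * cs 0)))) {0..y}"
      using y by (simp add: primitive_on_def)
    then show "((\<lambda>t. q t * u t * sin (l * of_real (y - t))) has_integral
        (l * u y - (v 0 * sin (l * of_real y) + l * u 0 * cos (l * of_real y)))) {0..y}"
      by (simp add: sn_def cs_def mult.assoc)
    have "primitive_on a (\<lambda>t. v t * cs t + (- l) * (u t * sn t)) (\<lambda>t. q t * u t * cs t)"
      by (rule primitive_on_cong[OF primitive_on_lincomb[OF primitive_on_mult[OF pv pc] primitive_on_mult[OF pu ps], of 1 "-l"]])
         (auto simp: algebra_simps power2_eq_square)
    then have "((\<lambda>t. q t * u t * cs t) has_integral 
      ((v y * cs y + (- l) * (u y * sn y)) - (v 0 * cs 0 + (- l) * (u 0 * sn 0)))) {0..y}"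
      using y by (simp add: primitive_on_def)
    then show "((\<lambda>t. q t * u t * cos (l * of_real (y - t))) has_integral
        (v y - (v 0 * cos (l * of_real y) - l * u 0 * sin (l * of_real y)))) {0..y}"
      by (simp add: sn_def cs_def mult.assoc)
  qed
  have bound: "norm J \<le> M * Q * exp (\<tau> * y)"
    if J: "((\<lambda>t. q t * u t * T t) has_integral J) {0..y}" and y: "y \<in> {0..a}"
      and T: "\<And>t. t \<in> {0..y} \<Longrightarrow> norm (T t) \<le> exp (\<tau> * (y - t))"
      and M: "\<And>t. t \<in> {0..y} \<Longrightarrow> norm (u t) \<le> M * exp (\<tau> * t)" for J T y M
  proof -
    have "0 \<in> {0..y}" using y by auto
    from order_trans[OF norm_ge_zero M[OF this]] have M0: "M \<ge> 0" by simp
    have qy: "(\<lambda>t. norm (q t)) integrable_on {0..y}"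
      by (rule integrable_subinterval_real[OF qint]) (use y in simp)
    have "norm (integral {0..y} (\<lambda>t. q t * u t * T t)) \<le> integral {0..y} (\<lambda>t. (M * exp (\<tau> * y)) * norm (q t))"
    proof (rule integral_norm_bound_integral)
      fix t assume t: "t \<in> {0..y}"
      have "norm (q t * u t * T t) \<le> norm (q t) * (M * exp (\<tau> * t)) * exp (\<tau> * (y - t))"
        unfolding norm_mult by (intro mult_mono M T t) (use M0 in auto)
      also have "exp (\<tau> * t) * exp (\<tau> * (y - t)) = exp (\<tau> * y)"
        by (simp add: exp_add[symmetric] algebra_simps)
      then have "norm (q t) * (M * exp (\<tau> * t)) * exp (\<tau> * (y - t)) = (M * exp (\<tau> * y)) * norm (q t)"
        by (metis (no_types, lifting) mult.assoc mult.commute)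
      finally show "norm (q t * u t * T t) \<le> (M * exp (\<tau> * y)) * norm (q t)" .
    qed (use J has_integral_integrable integrable_on_cmult_left[OF qy, of "M * exp (\<tau> * y)"] in auto)
    also have "\<dots> = (M * exp (\<tau> * y)) * integral {0..y} (\<lambda>t. norm (q t))" by simp
    also have "\<dots> \<le> (M * exp (\<tau> * y)) * Q"
    proof (intro mult_left_mono)
      have "integral {0..y} (\<lambda>t. norm (q t)) \<le> integral {0..a} (\<lambda>t. norm (q t))"
        using y by (intro integral_subset_le qy qint) auto
      then show "integral {0..y} (\<lambda>t. norm (q t)) \<le> Q" using Q by simp
    qed (use M0 in auto)
    finally show ?thesis using integral_unique[OF J] by (simp add: mult_ac)
  qed
  have trig: "norm (sin (l * of_real (y - t))) \<le> exp (\<tau> * (y - t))" 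
    "norm (cos (l * of_real (y - t))) \<le> exp (\<tau> * (y - t))" if "t \<in> {0..y}" for t y
    using norm_sin_cos_le_exp_Im[of "y - t" l] that by (auto simp: \<tau>_def)
  \<comment> \<open>Absorbing the maximum of the weighted modulus takes the place of Gronwall's inequality.\<close>
  define g where "g t = norm (u t) * exp (- (\<tau> * t))" for t
  have "continuous_on {0..a} g"
    unfolding g_def by (intro continuous_intros schroedinger_continuous(1)[OF s])
  then obtain t0 where t0: "t0 \<in> {0..a}" "\<And>t. t \<in> {0..a} \<Longrightarrow> g t \<le> g t0"
    using continuous_attains_sup[of "{0..a}" g] a by auto
  define M where "M = g t0"
  have uM: "norm (u t) \<le> M * exp (\<tau> * t)" if "t \<in> {0..a}" for t
  proof -
    have "norm (u t) = g t * exp (\<tau> * t)" by (simp add: g_def exp_minus)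
    also have "\<dots> \<le> M * exp (\<tau> * t)" using t0(2)[OF that] by (simp add: M_def)
    finally show ?thesis .
  qed
  have ln: "norm l > 0" using l by simp
  have main: "norm (l * u t0) \<le> norm l * B * exp (\<tau> * t0) + M * Q * exp (\<tau> * t0)"
  proof -
    have "norm (l * u t0 - (v 0 * sin (l * of_real t0) + l * u 0 * cos (l * of_real t0))) \<le> M * Q * exp (\<tau> * t0)"
      by (rule bound[OF rep(1)[OF t0(1)] t0(1)]) (use trig uM t0(1) in auto)
    moreover have "norm (v 0 * sin (l * of_real t0) + l * u 0 * cos (l * of_real t0)) \<le> norm l * B * exp (\<tau> * t0)"
    proof -
      have "norm (v 0 * sin (l * of_real t0) + l * u 0 * cos (l * of_real t0)) \<le>
         norm (v 0) * norm (sin (l * of_real t0)) + norm (l * u 0) * norm (cos (l * of_real t0))"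
        by (metis norm_mult norm_triangle_ineq)
      also have "\<dots> \<le> norm (v 0) * exp (\<tau> * t0) + norm (l * u 0) * exp (\<tau> * t0)"
        by (intro add_mono mult_left_mono) (use trig[of 0 t0] t0 in auto)
      also have "\<dots> = norm l * (norm (u 0) + norm (v 0) / norm l) * exp (\<tau> * t0)"
        using ln by (simp add: field_simps norm_mult)
      also have "\<dots> \<le> norm l * B * exp (\<tau> * t0)"
        by (intro mult_right_mono mult_left_mono B) auto
      finally show ?thesis .
    qed
    ultimately show ?thesis
      using norm_triangle_ineq[of "l * u t0 - (v 0 * sin (l * of_real t0) + l * u 0 * cos (l * of_real t0))"
         "v 0 * sin (l * of_real t0) + l * u 0 * cos (l * of_real t0)"] by simp
  qed
  have M0: "M \<ge> 0" by (simp add: M_def g_def)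
  have "M \<le> 2 * B"
  proof -
    have "norm (u t0) = M * exp (\<tau> * t0)" by (simp add: M_def g_def exp_minus)
    then have "norm l * M * exp (\<tau> * t0) \<le> (norm l * B + M * Q) * exp (\<tau> * t0)"
      using main by (simp add: norm_mult algebra_simps)
    then have "norm l * M \<le> norm l * B + M * Q" by simp
    moreover have "M * (2 * Q) \<le> M * norm l" using l M0 by (intro mult_left_mono) auto
    ultimately have "norm l * M \<le> norm l * (2 * B)" by (simp add: algebra_simps)
    then show ?thesis using ln by simp
  qed
  then have uB: "norm (u t) \<le> 2 * B * exp (\<tau> * t)" if "t \<in> {0..a}" for t
    using order_trans[OF uM[OF that] mult_right_mono[of M "2 * B" "exp (\<tau> * t)"]] by simp
  show "norm (u x) \<le> 2 * B * exp (\<bar>Im l\<bar> * x)" using uB[OF x] by (simp add: \<tau>_def)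
  show "norm (l * u x - (v 0 * sin (l * of_real x) + l * u 0 * cos (l * of_real x))) \<le> 2 * B * Q * exp (\<bar>Im l\<bar> * x)"
    unfolding \<tau>_def[symmetric] by (rule bound[OF rep(1)[OF x] x]) (use trig uB x in auto)
  show "norm (v x - (v 0 * cos (l * of_real x) - l * u 0 * sin (l * of_real x))) \<le> 2 * B * Q * exp (\<bar>Im l\<bar> * x)"
    unfolding \<tau>_def[symmetric] by (rule bound[OF rep(2)[OF x] x]) (use trig uB x in auto)
qed

section \<open>Zero-free quotients of functions of exponential type\<close>

text \<open>The map \<open>w \<mapsto> w / (2 A - w)\<close> sends the half-plane \<open>Re w < A\<close> into the unit disc and fixes \<open>0\<close>, so
  Schwarz's lemma applies to its composition with \<open>f\<close>.\<close>

lemma Borel_Caratheodory_half_radius: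
  assumes hol: "f holomorphic_on ball 0 R" and f0: "f 0 = 0" and R: "R > 0"
    and re: "\<And>w. norm w < R \<Longrightarrow> Re (f w) < A" and z: "norm z \<le> R / 2"
  shows "norm (f z) \<le> 2 * A"
proof -
  have A: "A > 0" using re[of 0] f0 R by simp
  define g where "g w = f (of_real R * w) / (of_real (2 * A) - f (of_real R * w))" for w
  have inball: "norm (of_real R * w) < R" if "norm w < 1" for w :: complex
    using that R by (simp add: norm_mult)
  have nz: "of_real (2 * A) - f w \<noteq> 0" if "norm w < R" for w
  proof
    assume "of_real (2 * A) - f w = 0"
    then have "Re (f w) = 2 * A" by (metis Re_complex_of_real eq_iff_diff_eq_0)
    then show False using re[OF that] A by simp
  qed
  have lt: "norm (f w) < norm (of_real (2 * A) - f w)" if "norm w < R" for w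
  proof -
    have "(norm (of_real (2 * A) - f w))\<^sup>2 - (norm (f w))\<^sup>2 = 4 * A * (A - Re (f w))"
      by (simp add: cmod_power2) algebra
    moreover have "4 * A * (A - Re (f w)) > 0" using re[OF that] A by simp
    ultimately have "(norm (f w))\<^sup>2 < (norm (of_real (2 * A) - f w))\<^sup>2" by linarith
    then show ?thesis by (rule power2_less_imp_less) simp
  qed
  have "g holomorphic_on ball 0 1"
  proof -
    have "(f \<circ> (\<lambda>w. of_real R * w)) holomorphic_on ball 0 1"
      by (rule holomorphic_on_compose_gen[OF _ hol]) (use inball in \<open>auto intro!: holomorphic_intros\<close>)
    then have h: "(\<lambda>w. f (of_real R * w)) holomorphic_on ball 0 1" by (simp add: o_def)
    show ?thesis unfolding g_def
      by (intro holomorphic_on_divide holomorphic_on_diff h holomorphic_on_const) (use nz inball in auto)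
  qed
  moreover have "g 0 = 0" by (simp add: g_def f0)
  moreover have "norm (g w) < 1" if "norm w < 1" for w
  proof -
    note i = inball[OF that]
    have "norm (of_real (2 * A) - f (of_real R * w)) > 0" using nz[OF i] by simp
    then show ?thesis using lt[OF i] unfolding g_def norm_divide by (simp add: divide_less_eq)
  qed
  moreover have "norm (z / of_real R) < 1" using z R by (simp add: norm_divide)
  ultimately have "norm (g (z / of_real R)) \<le> norm (z / of_real R)" by (rule Schwarz_Lemma(1))
  also have "\<dots> \<le> 1/2" using z R by (simp add: norm_divide field_simps)
  finally have "norm (g (z / of_real R)) \<le> 1/2" .
  moreover have "norm z < R" using z R by simp
  then have pos: "norm (of_real (2 * A) - f z) > 0" using nz by simp
  ultimately have "norm (f z) \<le> 1/2 * norm (of_real (2 * A) - f z)"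
    using R unfolding g_def norm_divide by (simp add: pos_divide_le_eq)
  also have "\<dots> \<le> 1/2 * (2 * A + norm (f z))"
    using norm_triangle_ineq4[of "of_real (2 * A)" "f z"] A by simp
  finally show ?thesis by simp
qed

lemma entire_bound_from_circle:
  fixes H :: "complex \<Rightarrow> complex"
  assumes H: "H holomorphic_on UNIV" and K: "\<And>z. norm z = r \<Longrightarrow> norm (H z) \<le> K" and z: "norm z \<le> r"
  shows "norm (H z) \<le> K"
proof (rule maximum_modulus_frontier[of H "cball 0 r"])
  show "H holomorphic_on interior (cball 0 r)" using H holomorphic_on_subset by blast
  show "continuous_on (closure (cball 0 r)) H"
    using H holomorphic_on_imp_continuous_on continuous_on_subset by blast
  show "norm (H w) \<le> K" if "w \<in> frontier (cball 0 r)" for w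
  proof (cases "r = 0")
    case True then show ?thesis using that K[of w] by (simp add: frontier_def)
  next
    case False then show ?thesis using that K by (simp add: frontier_cball)
  qed
qed (use z in auto)

lemma prod_linear_factors_lower_bound:
  fixes \<zeta> :: "nat \<Rightarrow> complex"
  assumes "\<And>k. k < n \<Longrightarrow> \<zeta> k \<noteq> 0 \<and> norm (\<zeta> k) < R" and "norm z = (m + 1) * R" and "R > 0" "m \<ge> 0"
  shows "m ^ n \<le> norm (\<Prod>k<n. 1 - z / \<zeta> k)"
proof -
  have "m \<le> norm (1 - z / \<zeta> k)" if "k < n" for k
  proof -
    have "m + 1 \<le> norm (z / \<zeta> k)"
      using assms(1)[OF that] assms(2-4) by (simp add: norm_divide pos_le_divide_eq mult_left_mono)
    then show ?thesis using norm_triangle_ineq2[of "z / \<zeta> k" 1] by (simp add: norm_minus_commute)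
  qed
  then have "(\<Prod>k<n. m) \<le> (\<Prod>k<n. norm (1 - z / \<zeta> k))"
    using assms(4) by (intro prod_mono) auto
  then show ?thesis by (simp add: prod_norm)
qed

text \<open>Zeros are divided out one at a time. On the circle of radius \<open>3 R\<close> every factor \<open>1 - z/\<zeta>\<close> has
  modulus at least \<open>2\<close>, so after \<open>n\<close> divisions \<open>2\<^sup>n |f(0)|\<close> is still at most the maximum of \<open>|f|\<close>
  there. Hence the process stops, and multiplicities need no separate count.\<close>

lemma factor_out_zeros_in_disc:
  fixes f :: "complex \<Rightarrow> complex"
  assumes f: "f holomorphic_on UNIV" and f0: "f 0 \<noteq> 0" and R: "R > 0"
  obtains n :: nat and \<zeta> H where "\<And>k. k < n \<Longrightarrow> \<zeta> k \<noteq> 0 \<and> norm (\<zeta> k) < R" "H holomorphic_on UNIV"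
    "\<And>z. f z = (\<Prod>k<n. 1 - z / \<zeta> k) * H z" "\<And>z. norm z < R \<Longrightarrow> H z \<noteq> 0"
proof -
  define factored where "factored n \<zeta> H \<longleftrightarrow> (\<forall>k<n. \<zeta> k \<noteq> 0 \<and> norm (\<zeta> k) < R) \<and> H holomorphic_on UNIV \<and>
      (\<forall>z. f z = (\<Prod>k<n. 1 - z / \<zeta> k) * H z)" for n and \<zeta> :: "nat \<Rightarrow> complex" and H
  have "\<exists>n \<zeta> H. factored n \<zeta> H \<and> (\<forall>z. norm z < R \<longrightarrow> H z \<noteq> 0)"
  proof (rule ccontr)
    assume "\<not> ?thesis"
    then have no: "\<exists>w. norm w < R \<and> H w = 0" if "factored n \<zeta> H" for n \<zeta> H using that by blast
    have ex: "\<exists>\<zeta> H. factored n \<zeta> H" for n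
    proof (induction n)
      case 0
      show ?case using f by (auto simp: factored_def)
    next
      case (Suc n)
      then obtain \<zeta> H where F: "factored n \<zeta> H" by blast
      obtain w where w: "norm w < R" "H w = 0" using no[OF F] by blast
      have H: "H holomorphic_on UNIV" using F by (simp add: factored_def)
      have H0: "H 0 = f 0" using F by (simp add: factored_def)
      have w0: "w \<noteq> 0" using w H0 f0 by auto
      define h where "h z = (if z = w then deriv H w else (H z - H w) / (z - w))" for z
      have h: "h holomorphic_on UNIV"
        unfolding h_def by (rule pole_lemma[OF H]) simp
      have Hh: "H z = (1 - z / w) * (- w * h z)" for z
      proof -
        have "H z = (z - w) * h z" using w by (simp add: h_def)
        moreover have "(1 - z / w) * (- w) = z - w" using w0 by (simp add: field_simps)
        ultimately show ?thesis by (metis mult.assoc)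
      qed
      have "factored (Suc n) (\<zeta>(n := w)) (\<lambda>z. - w * h z)"
        unfolding factored_def
      proof (intro conjI allI impI)
        fix k assume "k < Suc n"
        then show "(\<zeta>(n := w)) k \<noteq> 0" "norm ((\<zeta>(n := w)) k) < R"
          using F w w0 by (auto simp: factored_def less_Suc_eq)
      next
        show "(\<lambda>z. - w * h z) holomorphic_on UNIV" by (intro holomorphic_intros h)
        fix z
        have "f z = (\<Prod>k<n. 1 - z / \<zeta> k) * H z" using F by (simp add: factored_def)
        then show "f z = (\<Prod>k<Suc n. 1 - z / (\<zeta>(n := w)) k) * (- w * h z)"
          unfolding Hh[of z] by (simp add: mult.assoc)
      qed
      then show ?case by blast
    qed
    obtain M where M: "\<And>z. norm z = 3 * R \<Longrightarrow> norm (f z) \<le> M"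
    proof -
      have "compact (f ` sphere 0 (3 * R))"
        using f by (intro compact_continuous_image continuous_on_subset[OF holomorphic_on_imp_continuous_on]) auto
      then have "bounded (f ` sphere 0 (3 * R))" by (rule compact_imp_bounded)
      then obtain M where "\<And>y. y \<in> f ` sphere 0 (3 * R) \<Longrightarrow> norm y \<le> M"
        unfolding bounded_iff by auto
      then have "norm (f z) \<le> M" if "norm z = 3 * R" for z using that by simp
      then show ?thesis by (rule that)
    qed
    have bound: "2 ^ n * norm (f 0) \<le> M" for n :: nat
    proof -
      obtain \<zeta> H where F: "factored n \<zeta> H" using ex by blast
      have "norm (H 0) \<le> M / 2 ^ n"
      proof (rule entire_bound_from_circle[of H "3 * R"])
        show "H holomorphic_on UNIV" using F by (simp add: factored_def)
        fix z :: complex assume z: "norm z = 3 * R"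
        have "2 ^ n * norm (H z) \<le> norm (\<Prod>k<n. 1 - z / \<zeta> k) * norm (H z)"
          by (intro mult_right_mono prod_linear_factors_lower_bound[where R=R]) (use F z R in \<open>auto simp: factored_def\<close>)
        also have "\<dots> = norm (f z)" using F by (simp add: factored_def norm_mult)
        also have "\<dots> \<le> M" by (rule M[OF z])
        finally show "norm (H z) \<le> M / 2 ^ n" by (simp add: field_simps)
      qed (use R in auto)
      moreover have "H 0 = f 0" using F by (simp add: factored_def)
      ultimately show ?thesis by (simp add: field_simps)
    qed
    obtain n where "M / norm (f 0) < 2 ^ n" using real_arch_pow[of 2 "M / norm (f 0)"] by auto
    then show False using bound[of n] f0 by (simp add: pos_divide_less_eq)
  qed
  then obtain n \<zeta> H where "factored n \<zeta> H" "\<And>z. norm z < R \<Longrightarrow> H z \<noteq> 0" by blast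
  then show ?thesis using that[of n \<zeta> H] by (auto simp: factored_def)
qed

text \<open>\<open>f\<close> and \<open>f F\<close> have the same zeros in the disc, so one product of linear factors, of modulus at least
  \<open>1\<close> on the circle of radius \<open>2 R\<close>, is removed from both without increasing their maximum there.
  What remains of \<open>f\<close> is zero-free in the disc of radius \<open>R\<close>; its logarithm has real part bounded above, so
  Borel--Caratheodory bounds it from below as well, and \<open>F\<close> is the quotient of the two remainders.\<close>

lemma zero_free_quotient_bound:
  fixes f F :: "complex \<Rightarrow> complex"
  assumes f: "f holomorphic_on UNIV" and F: "F holomorphic_on UNIV" and f0: "f 0 \<noteq> 0" and R: "R > 0"
    and M: "\<And>z. norm z = 2 * R \<Longrightarrow> norm (f z) \<le> M" "\<And>z. norm z = 2 * R \<Longrightarrow> norm (f z * F z) \<le> M"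
    and A: "ln (M / norm (f 0)) < A" and z: "norm z \<le> R / 2"
  shows "norm (F z) \<le> M / norm (f 0) * exp (2 * A)"
proof -
  obtain n :: nat and \<zeta> H where \<zeta>: "\<And>k. k < n \<Longrightarrow> \<zeta> k \<noteq> 0 \<and> norm (\<zeta> k) < R" and H: "H holomorphic_on UNIV"
    and fH: "\<And>z. f z = (\<Prod>k<n. 1 - z / \<zeta> k) * H z" and Hnz: "\<And>z. norm z < R \<Longrightarrow> H z \<noteq> 0"
    using factor_out_zeros_in_disc[OF f f0 R] by blast
  have H0: "H 0 = f 0" using fH[of 0] by simp
  have HM: "norm (H w) \<le> M" "norm (H w * F w) \<le> M" if "norm w \<le> 2 * R" for w
  proof -
    have le: "norm (H w) \<le> norm (f w)" if w: "norm w = 2 * R" for w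
    proof -
      have "1 ^ n \<le> norm (\<Prod>k<n. 1 - w / \<zeta> k)"
        by (rule prod_linear_factors_lower_bound[where R=R]) (use \<zeta> w R in auto)
      then have "1 * norm (H w) \<le> norm (\<Prod>k<n. 1 - w / \<zeta> k) * norm (H w)"
        by (intro mult_right_mono) auto
      then show ?thesis by (simp add: fH norm_mult)
    qed
    show "norm (H w) \<le> M"
      by (rule entire_bound_from_circle[OF H _ that]) (use le M(1) in \<open>force intro: order_trans\<close>)
    show "norm (H w * F w) \<le> M"
    proof (rule entire_bound_from_circle[OF _ _ that])
      show "(\<lambda>w. H w * F w) holomorphic_on UNIV" by (intro holomorphic_intros H F)
      fix w :: complex assume w: "norm w = 2 * R"
      have "norm (H w * F w) \<le> norm (f w * F w)"
        unfolding norm_mult by (intro mult_right_mono le w) auto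
      then show "norm (H w * F w) \<le> M" using M(2)[OF w] by simp
    qed
  qed
  obtain g where g: "g holomorphic_on ball 0 R" "\<And>w. w \<in> ball 0 R \<Longrightarrow> H w = exp (g w)"
    by (rule contractible_imp_holomorphic_log[of H "ball 0 R"])
       (use H Hnz R in \<open>auto intro: holomorphic_on_subset convex_imp_contractible\<close>)
  have f0': "norm (f 0) = exp (Re (g 0))" using g(2)[of 0] R H0 by simp
  have M0: "M > 0" using HM(1)[of 0] H0 f0 R by (smt (verit) zero_less_norm_iff norm_zero)
  have "norm (g z - g 0) \<le> 2 * A"
  proof (rule Borel_Caratheodory_half_radius[OF _ _ R _ z])
    show "(\<lambda>w. g w - g 0) holomorphic_on ball 0 R" by (intro holomorphic_intros g)
    fix w :: complex assume w: "norm w < R"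
    have "exp (Re (g w)) \<le> M" using HM(1)[of w] w R g(2)[of w] by simp
    then have "Re (g w) \<le> ln M" using M0 by (metis exp_gt_zero ln_exp ln_le_cancel_iff)
    moreover have "ln (M / norm (f 0)) = ln M - Re (g 0)"
      using M0 f0' by (simp add: ln_div)
    ultimately show "Re (g w - g 0) < A" using A by simp
  qed simp
  then have re: "- (2 * A) \<le> Re (g z - g 0)" using abs_Re_le_cmod[of "g z - g 0"] by linarith
  have zR: "norm z < R" using z R by simp
  have "norm (H z) = norm (f 0) * exp (Re (g z - g 0))"
    using g(2)[of z] zR f0' by (simp add: exp_diff)
  then have "norm (H z) \<ge> norm (f 0) * exp (- (2 * A))"
    using re by (simp add: mult_left_mono)
  then have "norm (f 0) * exp (- (2 * A)) * norm (F z) \<le> norm (H z) * norm (F z)"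
    by (intro mult_right_mono) auto
  also have "\<dots> \<le> M" using HM(2)[of z] zR R by (simp add: norm_mult)
  finally show ?thesis using f0 by (simp add: exp_minus field_simps)
qed

text \<open>With \<open>R\<close> proportional to \<open>|z|\<close> the preceding bound shows that \<open>F\<close> itself is of exponential type.
  Thus \<open>F = exp G\<close> with the real part of \<open>G\<close> growing at most linearly; by Borel--Caratheodory so
  does \<open>G\<close>, and Liouville makes \<open>G\<close> a polynomial of degree at most \<open>1\<close>.\<close>

theorem zero_free_quotient_of_exponential_type:
  fixes f F :: "complex \<Rightarrow> complex"
  assumes f: "f holomorphic_on UNIV" and F: "F holomorphic_on UNIV" and f0: "f 0 \<noteq> 0"
    and nz: "\<And>z. F z \<noteq> 0"
    and type: "\<And>z. norm (f z) \<le> C * exp (K * norm z)" "\<And>z. norm (f z * F z) \<le> C * exp (K * norm z)"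
  obtains b c where "\<And>z. F z = exp (b * z + c)"
proof -
  define D where "D = C / norm (f 0)"
  have D: "D \<ge> 1" using type(1)[of 0] f0 by (simp add: D_def pos_le_divide_eq)
  define C1 where "C1 = 3 * ln D + 2"
  define C2 where "C2 = 12 * K"
  have Fb: "norm (F z) \<le> exp (C1 + C2 * r)" if r: "r > 0" and z: "norm z \<le> r" for z r
  proof -
    define M where "M = C * exp (K * (4 * r))"
    have MD: "M / norm (f 0) = exp (ln D + 4 * K * r)"
      using D by (simp add: M_def D_def exp_add mult_ac)
    have "norm (F z) \<le> M / norm (f 0) * exp (2 * (ln D + 4 * K * r + 1))"
    proof (rule zero_free_quotient_bound[OF f F f0, of "2 * r"])
      show "norm (f w) \<le> M" "norm (f w * F w) \<le> M" if "norm w = 2 * (2 * r)" for w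
        using type[of w] that by (simp_all add: M_def)
    qed (use r z MD in auto)
    also have "\<dots> = exp (C1 + C2 * r)"
      unfolding MD exp_add[symmetric] C1_def C2_def by (simp add: algebra_simps)
    finally show ?thesis .
  qed
  obtain G where G: "G holomorphic_on UNIV" "\<And>w. F w = exp (G w)"
    by (rule contractible_imp_holomorphic_log[OF F]) (use nz in \<open>auto intro: convex_imp_contractible\<close>)
  define B where "B = 2 * (\<bar>C1\<bar> + norm (G 0) + 1 + 2 * \<bar>C2\<bar>)"
  have lin: "norm (G z - G 0) \<le> B * norm z ^ 1" if z: "1 \<le> norm z" for z
  proof -
    define A where "A = C1 + norm (G 0) + 1 + C2 * (2 * norm z)"
    have "norm (G z - G 0) \<le> 2 * A"
    proof (rule Borel_Caratheodory_half_radius[of "\<lambda>w. G w - G 0" "2 * norm z"])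
      show "(\<lambda>w. G w - G 0) holomorphic_on ball 0 (2 * norm z)"
        by (intro holomorphic_intros holomorphic_on_subset[OF G(1)]) auto
      fix w :: complex assume w: "norm w < 2 * norm z"
      have "exp (Re (G w)) \<le> exp (C1 + C2 * (2 * norm z))"
        using Fb[of "2 * norm z" w] w z unfolding G(2)[of w] norm_exp_eq_Re by linarith
      then have "Re (G w) \<le> C1 + C2 * (2 * norm z)" by simp
      moreover have "- Re (G 0) \<le> norm (G 0)" using abs_Re_le_cmod[of "G 0"] by linarith
      ultimately show "Re (G w - G 0) < A" by (simp add: A_def)
    qed (use z in auto)
    also have "2 * A \<le> B * norm z"
    proof -
      have "C1 + norm (G 0) + 1 \<le> (\<bar>C1\<bar> + norm (G 0) + 1) * norm z"
        using mult_left_mono[OF z, of "\<bar>C1\<bar> + norm (G 0) + 1"] by simp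
      moreover have "C2 * (2 * norm z) \<le> 2 * \<bar>C2\<bar> * norm z"
        using mult_right_mono[of C2 "\<bar>C2\<bar>" "2 * norm z"] by (simp add: mult_ac)
      ultimately show ?thesis by (simp add: A_def B_def algebra_simps)
    qed
    finally show ?thesis by simp
  qed
  have hol: "(\<lambda>w. G w - G 0) holomorphic_on UNIV" by (intro holomorphic_intros G)
  define b where "b = deriv (\<lambda>w. G w - G 0) 0"
  have "G z - G 0 = b * z" for z
    using Liouville_polynomial[OF hol lin, where \<xi>=z] by (simp add: b_def)
  then have Gz: "G z = b * z + G 0" for z by (metis diff_add_cancel)
  show ?thesis
  proof (rule that[of b "G 0"])
    show "F z = exp (b * z + G 0)" for z
      unfolding G(2)[of z] using Gz[of z] by (rule arg_cong)
  qed
qed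

section \<open>Functions with vanishing indefinite integral\<close>

text \<open>The sets over which the integral vanishes include the half-lines and are closed under complements
  and disjoint countable unions, so they include the Borel sets, and up to null sets the Lebesgue
  measurable ones.\<close>

lemma AE_zero_if_integrals_zero:
  fixes f :: "real \<Rightarrow> complex"
  assumes f: "f absolutely_integrable_on {0..a}" and a: "a \<ge> 0"
    and z: "\<And>x. x \<in> {0..a} \<Longrightarrow> integral {0..x} f = 0"
  shows "AE x in lebesgue_on {0<..<a}. f x = 0"
proof -
  define g where "g x = indicat_real {0..a} x *\<^sub>R f x" for x
  have g: "integrable lebesgue g"
    using f by (simp add: set_integrable_def g_def[abs_def])
  have gA: "set_integrable lebesgue A g" if "A \<in> sets lebesgue" for A
    using integrable_mult_indicator[OF that g] by (simp add: set_integrable_def)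
  have gI: "integral\<^sup>L lebesgue g = 0"
    using set_lebesgue_integral_eq_integral(2)[OF f] z[of a] a
    by (simp add: set_lebesgue_integral_def g_def[abs_def])
  have sets_borel: "sets borel = sigma_sets UNIV (range (\<lambda>c::real. {..c}))"
    by (subst borel_eq_atMost) (simp add: sets_measure_of)
  have borel: "set_lebesgue_integral lebesgue B g = 0" if "B \<in> sets borel" for B
  proof -
    have stable: "Int_stable (range (\<lambda>c::real. {..c}))" by (auto simp: Int_stable_def)
    have subs: "range (\<lambda>c::real. {..c}) \<subseteq> Pow UNIV" by simp
    have "B \<in> sigma_sets UNIV (range (\<lambda>c::real. {..c}))"
      using that by (simp add: sets_borel)
    then show ?thesis
    proof (induction rule: sigma_sets_induct_disjoint[OF stable subs, consumes 1, case_names basic empty compl union])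
      case (basic A)
      then obtain c where A: "A = {..c}" by blast
      show ?case
      proof (cases "c < 0")
        case True
        then have "(\<lambda>x. indicat_real A x *\<^sub>R g x) = (\<lambda>x. 0)"
          by (auto simp: A g_def indicator_def)
        then show ?thesis by (simp add: set_lebesgue_integral_def)
      next
        case False
        define x where "x = min c a"
        have x: "x \<in> {0..a}" using False a by (auto simp: x_def)
        have fx: "f absolutely_integrable_on {0..x}"
          by (rule set_integrable_subset[OF f]) (use x in auto)
        have "(\<lambda>y. indicat_real A y *\<^sub>R g y) = (\<lambda>y. indicat_real {0..x} y *\<^sub>R f y)"
          by (auto simp: A g_def x_def indicator_def fun_eq_iff)
        then show ?thesis
          using set_lebesgue_integral_eq_integral(2)[OF fx] z[OF x]
          by (simp add: set_lebesgue_integral_def)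
      qed
    next
      case empty
      show ?case by (simp add: set_lebesgue_integral_def)
    next
      case (compl A)
      have "A \<in> sets borel" using compl(1) by (simp add: sets_borel)
      then have A: "A \<in> sets lebesgue" by auto
      have "(\<lambda>x. indicat_real (UNIV - A) x *\<^sub>R g x) = (\<lambda>x. g x - indicat_real A x *\<^sub>R g x)"
        by (auto simp: indicator_def fun_eq_iff)
      then show ?case
        using Bochner_Integration.integral_diff[OF g gA[OF A, unfolded set_integrable_def]] compl(2) gI
        by (simp add: set_lebesgue_integral_def)
    next
      case (union A)
      have A: "A i \<in> sets lebesgue" for i
      proof -
        have "A i \<in> sets borel" using union(2) by (auto simp: sets_borel)
        then show ?thesis by auto
      qed
      have "set_lebesgue_integral lebesgue (\<Union>i. A i) g = (\<Sum>i. set_lebesgue_integral lebesgue (A i) g)"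
      proof (rule lebesgue_integral_countable_add)
        show "A i \<inter> A j = {}" if "i \<noteq> j" for i j
          using union(1) that by (simp add: disjoint_family_on_def)
        show "set_integrable lebesgue (\<Union>i. A i) g" using A by (intro gA) auto
      qed (use A in auto)
      then show ?case using union(3) by simp
    qed
  qed
  have leb: "set_lebesgue_integral lebesgue A g = 0" if A: "A \<in> sets lebesgue" for A
  proof -
    define B where "B = main_part lborel A"
    have B: "B \<in> sets borel" unfolding B_def using main_part_sets[OF A] by simp
    have "A = B \<union> null_part lborel A" "null_part lborel A \<in> null_sets lebesgue"
      using A null_part_null_sets by (auto simp: B_def main_part_null_part_Un)
    then have "AE x in lebesgue. x \<in> A \<longleftrightarrow> x \<in> B"
      by (intro AE_I'[of "null_part lborel A"]) auto
    then have "set_lebesgue_integral lebesgue A g = set_lebesgue_integral lebesgue B g"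
      unfolding set_lebesgue_integral_def
    proof (intro integral_cong_AE)
      have B': "B \<in> sets lebesgue" using B by auto
      show "(\<lambda>x. indicat_real B x *\<^sub>R g x) \<in> borel_measurable lebesgue"
        by (rule borel_measurable_scaleR[OF borel_measurable_indicator[OF B'] borel_measurable_integrable[OF g]])
      show "(\<lambda>x. indicat_real A x *\<^sub>R g x) \<in> borel_measurable lebesgue"
        by (rule borel_measurable_scaleR[OF borel_measurable_indicator[OF A] borel_measurable_integrable[OF g]])
      show "AE x in lebesgue. indicat_real A x *\<^sub>R g x = indicat_real B x *\<^sub>R g x"
        using \<open>AE x in lebesgue. x \<in> A \<longleftrightarrow> x \<in> B\<close> by eventually_elim (simp add: indicator_def)
    qed
    then show ?thesis using borel[OF B] by simp
  qed
  have "sigma_finite_measure (lebesgue :: real measure)"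
  proof
    obtain C :: "real set set" where "countable C \<and> C \<subseteq> sets lborel \<and> \<Union>C = space lborel \<and>
        (\<forall>A\<in>C. emeasure lborel A \<noteq> \<infinity>)"
      using lborel.sigma_finite_countable by (rule exE)
    then have C: "countable C" "C \<subseteq> sets lborel" "\<Union>C = space lborel"
        "\<forall>A\<in>C. emeasure lborel A \<noteq> \<infinity>" by blast+
    have eq: "emeasure lebesgue A = emeasure lborel A" if "A \<in> C" for A
    proof -
      have "A \<in> sets lborel" using that C(2) by blast
      then show ?thesis by (metis emeasure_completion main_part sets_completionI_sets)
    qed
    show "\<exists>C :: real set set. countable C \<and> C \<subseteq> sets lebesgue \<and> \<Union>C = space lebesgue \<and>
        (\<forall>A\<in>C. emeasure lebesgue A \<noteq> \<infinity>)"
    proof (intro exI[of _ C] conjI ballI C(1))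
      show "C \<subseteq> sets lebesgue" using C(2) sets_completionI_sets by blast
      show "\<Union>C = space lebesgue" using C(3) by simp
      show "emeasure lebesgue A \<noteq> \<infinity>" if "A \<in> C" for A unfolding eq[OF that] using C(4) that by (rule bspec)
    qed
  qed
  then have "AE x in lebesgue. g x = 0" by (rule sigma_finite_measure.density_zero[OF _ g leb])
  then have "AE x in lebesgue. x \<in> {0<..<a} \<longrightarrow> f x = 0"
    by eventually_elim (auto simp: g_def)
  then show ?thesis by (simp add: AE_restrict_space_iff)
qed

section \<open>The characteristic function of a symmetric problem\<close>

lemma holomorphic_comp_square:
  fixes F :: "complex \<Rightarrow> complex"
  assumes "F holomorphic_on UNIV"
  shows "(\<lambda>l. F (l\<^sup>2)) holomorphic_on UNIV"
proof -
  have "(F \<circ> (\<lambda>l. l\<^sup>2)) holomorphic_on UNIV"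
    by (rule holomorphic_on_compose_gen[OF _ assms]) (auto intro!: holomorphic_intros)
  then show ?thesis by (simp add: o_def)
qed

locale symmetric_problem =
  fixes a :: real and q :: "real \<Rightarrow> complex" and \<alpha> :: real and \<beta> :: complex
  assumes a: "a > 0" and q: "q absolutely_integrable_on {0..a}"
    and sym: "AE x in lebesgue_on {0<..<a}. q x = q (a - x)" and \<alpha>: "\<alpha> > 0"
begin

definition val :: "complex \<Rightarrow> complex \<Rightarrow> complex \<Rightarrow> real \<Rightarrow> complex" where
  "val z = ivp_value a (\<lambda>t. q t - z)"

definition der :: "complex \<Rightarrow> complex \<Rightarrow> complex \<Rightarrow> real \<Rightarrow> complex" where
  "der z = ivp_deriv a (\<lambda>t. q t - z)"

text \<open>The slope that the boundary condition prescribes at \<open>0\<close>.\<close>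

definition h :: "complex \<Rightarrow> complex" where "h l = \<i> * of_real \<alpha> * l + \<beta>"

text \<open>The three entire functions of \<open>z = l\<^sup>2\<close> that make up the characteristic function: \<open>A\<close> and \<open>S\<close> belong
  to a Dirichlet condition at \<open>a\<close>, and \<open>D\<close> to the problem with \<open>\<alpha> = 0\<close> at both ends.\<close>

definition A :: "complex \<Rightarrow> complex" where "A z = val z 1 \<beta> a"

definition S :: "complex \<Rightarrow> complex" where "S z = val z 0 1 a"

definition D :: "complex \<Rightarrow> complex" where "D z = der z 1 \<beta> a + \<beta> * A z"

definition \<Delta> :: "complex \<Rightarrow> complex" where "\<Delta> = char_fun a q \<alpha> \<beta> \<alpha> \<beta>"

lemma sol:
  "schroedinger_solution a (\<lambda>t. q t - z) (val z c d) (der z c d)" "val z c d 0 = c" "der z c d 0 = d"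
  using ivp_solution[OF absolutely_integrable_diff_const[OF q]] a by (auto simp: val_def der_def)

lemma sol_eqI:
  assumes "schroedinger_solution a (\<lambda>t. q t - z) u v" "u 0 = c" "v 0 = d" "x \<in> {0..a}"
  shows "u x = val z c d x" "v x = der z c d x"
  using ivp_eqI[OF absolutely_integrable_diff_const[OF q] assms] by (auto simp: val_def der_def)

lemma val_lincomb:
  assumes "x \<in> {0..a}"
  shows "val z (k * c + l * d) (k * c' + l * d') x = k * val z c c' x + l * val z d d' x"
    "der z (k * c + l * d) (k * c' + l * d') x = k * der z c c' x + l * der z d d' x"
  using ivp_lincomb[OF absolutely_integrable_diff_const[OF q] assms] by (auto simp: val_def der_def)

lemma reflected_sol:
  "schroedinger_solution a (\<lambda>t. q t - z) (\<lambda>x. val z c d (a - x)) (\<lambda>x. - der z c d (a - x))"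
proof (rule schroedinger_reflect[OF sol(1)])
  show "AE x in lebesgue_on {0<..<a}. q x - z = q (a - x) - z"
    using sym by eventually_elim simp
qed

text \<open>The solution with data \<open>(0,1)\<close>, reflected in the midpoint, is again a solution because the potential
  is symmetric; its Wronskian with the solution with data \<open>(1,\<beta>)\<close> is compared at the two ends.\<close>

lemma der_S: "der z 0 1 a = A z - \<beta> * S z"
proof -
  have aa: "a \<in> {0..a}" using a by simp
  from wronskian_constant[OF sol(1)[of z 1 \<beta>] reflected_sol[of z 0 1] aa]
  show ?thesis by (simp add: sol A_def S_def algebra_simps)
qed

lemma A_sq: "(A z)\<^sup>2 - S z * D z = 1"
proof -
  have aa: "a \<in> {0..a}" using a by simp
  have "A z * der z 0 1 a - der z 1 \<beta> a * S z = 1"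
    using wronskian_constant[OF sol(1)[of z 1 \<beta>] sol(1)[of z 0 1] aa] by (simp add: sol A_def S_def)
  then show ?thesis unfolding der_S D_def by (simp add: algebra_simps power2_eq_square)
qed

lemma val_h:
  assumes "x \<in> {0..a}"
  shows "val z 1 (h l) x = val z 1 \<beta> x + \<i> * of_real \<alpha> * l * val z 0 1 x"
    "der z 1 (h l) x = der z 1 \<beta> x + \<i> * of_real \<alpha> * l * der z 0 1 x"
  using val_lincomb[OF assms, of z 1 1 "\<i> * of_real \<alpha> * l" 0 \<beta> 1] by (simp_all add: h_def add.commute)

lemma \<Delta>_eq_boundary: "\<Delta> l = der (l\<^sup>2) 1 (h l) a + h l * val (l\<^sup>2) 1 (h l) a"
  unfolding \<Delta>_def using char_fun_eq[OF q, of \<alpha> \<beta> \<alpha> \<beta> l] a by (simp add: val_def der_def h_def)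

text \<open>\<open>A\<close>, \<open>D\<close> and \<open>S\<close> depend on \<open>l\<^sup>2\<close> only, so the middle term is the odd part of \<open>\<Delta>\<close> and the rest the even
  part.\<close>

lemma \<Delta>_eq: "\<Delta> l = D (l\<^sup>2) + 2 * \<i> * of_real \<alpha> * l * A (l\<^sup>2) - of_real (\<alpha>\<^sup>2) * l\<^sup>2 * S (l\<^sup>2)"
proof -
  have aa: "a \<in> {0..a}" using a by simp
  show ?thesis
    unfolding \<Delta>_eq_boundary val_h[OF aa] unfolding der_S D_def A_def[symmetric] S_def[symmetric] h_def
    by (simp add: algebra_simps power2_eq_square)
qed

lemma holomorphic_val:
  assumes "x \<in> {0..a}"
  shows "(\<lambda>z. val z c d x) holomorphic_on UNIV" "(\<lambda>z. der z c d x) holomorphic_on UNIV"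
  using ivp_holomorphic[OF q assms] by (simp_all add: val_def der_def)

lemma holomorphic_ASD: "A holomorphic_on UNIV" "S holomorphic_on UNIV" "D holomorphic_on UNIV"
proof -
  have aa: "a \<in> {0..a}" using a by simp
  show A: "A holomorphic_on UNIV" and "S holomorphic_on UNIV"
    unfolding A_def[abs_def] S_def[abs_def] by (intro holomorphic_val aa)+
  show "D holomorphic_on UNIV"
    unfolding D_def[abs_def] by (intro holomorphic_intros holomorphic_val aa A)
qed

lemma holomorphic_\<Delta>: "\<Delta> holomorphic_on UNIV"
proof -
  show ?thesis unfolding \<Delta>_eq[abs_def]
    by (intro holomorphic_intros holomorphic_comp_square[OF holomorphic_ASD(1)] holomorphic_comp_square[OF holomorphic_ASD(2)] holomorphic_comp_square[OF holomorphic_ASD(3)])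
qed

text \<open>The solution of the boundary condition at \<open>a\<close> is the reflection \<open>y(a - x)\<close> of the solution \<open>y\<close> of
  the condition at \<open>0\<close>; it is a combination of \<open>y\<close> and of the solution with data \<open>(0,1)\<close>, and the data at \<open>0\<close>
  determine the coefficients.\<close>

lemma reflected_val:
  assumes x: "x \<in> {0..a}"
  shows "\<Delta> l * val (l\<^sup>2) 0 1 x = val (l\<^sup>2) 1 (h l) a * val (l\<^sup>2) 1 (h l) x - val (l\<^sup>2) 1 (h l) (a - x)"
proof -
  define y where "y = val (l\<^sup>2) 1 (h l)"
  define y' where "y' = der (l\<^sup>2) 1 (h l)"
  have "y (a - x) = val (l\<^sup>2) (y a) (- y' a) x"
    unfolding y_def y'_def using sol_eqI(1)[OF reflected_sol _ _ x, of "l\<^sup>2" 1 "h l"] by simp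
  also have "\<dots> = y a * y x + (- \<Delta> l) * val (l\<^sup>2) 0 1 x"
    using val_lincomb(1)[OF x, of "l\<^sup>2" "y a" 1 "- \<Delta> l" 0 "h l" 1]
    unfolding \<Delta>_eq_boundary y_def y'_def by (simp add: algebra_simps)
  finally show ?thesis by (simp add: y_def)
qed

definition Q :: real where "Q = integral {0..a} (\<lambda>t. norm (q t))"

lemma Q_nonneg: "Q \<ge> 0"
  unfolding Q_def using q by (intro integral_nonneg) (auto simp: absolutely_integrable_on_def)

text \<open>\<open>B - 1\<close> bounds \<open>|h(l)| / |l|\<close> once \<open>|l| \<ge> 1\<close>, and \<open>R\<close> is the radius outside of which the
  asymptotics hold.\<close>

definition B :: real where "B = 1 + \<alpha> + norm \<beta>"

lemma B_ge: "B \<ge> 1" using \<alpha> by (simp add: B_def)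

definition R :: real where "R = 1 + 2 * Q"

lemma asymptotics:
  assumes l: "norm l \<ge> R" and d: "norm d \<le> norm l * (B - 1)" and x: "x \<in> {0..a}"
  shows "norm (val (l\<^sup>2) 1 d x) \<le> 2 * B * exp (\<bar>Im l\<bar> * x)"
    "norm (l * val (l\<^sup>2) 1 d x - (d * sin (l * of_real x) + l * cos (l * of_real x))) \<le> 2 * B * Q * exp (\<bar>Im l\<bar> * x)"
    "norm (der (l\<^sup>2) 1 d x - (d * cos (l * of_real x) - l * sin (l * of_real x))) \<le> 2 * B * Q * exp (\<bar>Im l\<bar> * x)"
proof -
  have l': "l \<noteq> 0" "2 * Q \<le> norm l" using l Q_nonneg by (auto simp: R_def)
  have "norm d / norm l \<le> B - 1" using d l' by (simp add: pos_divide_le_eq mult.commute)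
  then have B: "norm (val (l\<^sup>2) 1 d 0) + norm (der (l\<^sup>2) 1 d 0) / norm l \<le> B" by (simp add: sol)
  note s = schroedinger_asymptotics[OF q sol(1) _ l' x B]
  show "norm (val (l\<^sup>2) 1 d x) \<le> 2 * B * exp (\<bar>Im l\<bar> * x)"
    "norm (l * val (l\<^sup>2) 1 d x - (d * sin (l * of_real x) + l * cos (l * of_real x))) \<le> 2 * B * Q * exp (\<bar>Im l\<bar> * x)"
    "norm (der (l\<^sup>2) 1 d x - (d * cos (l * of_real x) - l * sin (l * of_real x))) \<le> 2 * B * Q * exp (\<bar>Im l\<bar> * x)"
    using s by (simp_all add: sol Q_def)
qed

lemma h_bound:
  assumes "norm l \<ge> R" shows "norm (h l) \<le> norm l * (B - 1)"
proof -
  have "norm l \<ge> 1" using assms Q_nonneg by (simp add: R_def)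
  have "norm (h l) \<le> norm (\<i> * of_real \<alpha> * l) + norm \<beta>" unfolding h_def by (rule norm_triangle_ineq)
  also have "norm (\<i> * of_real \<alpha> * l) = norm l * \<alpha>" using \<alpha> by (simp add: norm_mult)
  also have "norm \<beta> \<le> norm l * norm \<beta>" using mult_right_mono[OF \<open>norm l \<ge> 1\<close>, of "norm \<beta>"] by simp
  finally show ?thesis by (simp add: B_def algebra_simps)
qed

text \<open>The total of the error terms in the following asymptotics of \<open>\<Delta>\<close>.\<close>

definition err :: real where
  "err = 2 * norm \<beta> + 2 * \<alpha> * norm \<beta> + (norm \<beta>)\<^sup>2 + 2 * B * Q + B * (2 * B * Q)"

lemma err_nonneg: "err \<ge> 0" using \<alpha> B_ge Q_nonneg by (simp add: err_def)

text \<open>In terms of exponentials the leading part \<open>2 i \<alpha> l cos (l a) - (1 + \<alpha>\<^sup>2) l sin (l a)\<close> has coefficients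
  \<open>(1 + \<alpha>)\<^sup>2\<close> and \<open>(1 - \<alpha>)\<^sup>2\<close>. Their inequality for \<open>\<alpha> > 0\<close> distinguishes the two half-planes.\<close>

lemma \<Delta>_asymptotics:
  assumes l: "norm l \<ge> R"
  shows "norm (\<Delta> l - \<i> * l / 2 * ((1 + of_real \<alpha>)\<^sup>2 * exp (\<i> * l * of_real a)
           - (1 - of_real \<alpha>)\<^sup>2 * exp (- (\<i> * l * of_real a)))) \<le> err * exp (\<bar>Im l\<bar> * a)"
proof -
  define E where "E = exp (\<bar>Im l\<bar> * a)"
  define s where "s = sin (l * of_real a)"
  define c where "c = cos (l * of_real a)"
  have aa: "a \<in> {0..a}" using a by simp
  have l1: "norm l \<ge> 1" and l0: "l \<noteq> 0" using l Q_nonneg by (auto simp: R_def)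
  define e1 where "e1 = l * val (l\<^sup>2) 1 (h l) a - (h l * s + l * c)"
  define e2 where "e2 = der (l\<^sup>2) 1 (h l) a - (h l * c - l * s)"
  have e: "norm e1 \<le> 2 * B * Q * E" "norm e2 \<le> 2 * B * Q * E"
    using asymptotics(2,3)[OF l h_bound[OF l] aa] by (simp_all add: e1_def e2_def s_def c_def E_def)
  have sc: "norm s \<le> E" "norm c \<le> E"
    using norm_sin_cos_le_exp_Im[of a l] a by (simp_all add: s_def c_def E_def)
  have E0: "E > 0" by (simp add: E_def)
  have exp_pos_il: "exp (\<i> * l * of_real a) = c + \<i> * s"
    using exp_Euler[of "l * of_real a"] by (simp add: c_def s_def mult.assoc)
  have exp_neg_il: "exp (- (\<i> * l * of_real a)) = c - \<i> * s"
    using exp_Euler[of "- (l * of_real a)"] by (simp add: c_def s_def mult.assoc)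
  have main: "\<i> * l / 2 * ((1 + of_real \<alpha>)\<^sup>2 * exp (\<i> * l * of_real a)
           - (1 - of_real \<alpha>)\<^sup>2 * exp (- (\<i> * l * of_real a))) = 
        2 * \<i> * of_real \<alpha> * l * c - l * (1 + (of_real \<alpha>)\<^sup>2) * s"
    unfolding exp_pos_il exp_neg_il by (simp add: field_simps power2_eq_square)
  define k where "k = h l / l"
  have hk: "h l = k * l" using l0 by (simp add: k_def)
  have k: "norm k \<le> B"
  proof -
    have "norm k \<le> B - 1" unfolding k_def norm_divide
      using h_bound[OF l] l0 by (simp add: pos_divide_le_eq mult.commute)
    then show ?thesis by simp
  qed
  have "\<Delta> l = e2 + k * e1 + 2 * h l * c - l * s + k * h l * s"
    unfolding \<Delta>_eq_boundary e1_def e2_def hk by (simp add: algebra_simps)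
  also have "k * h l = - (l * (of_real \<alpha>)\<^sup>2) + 2 * \<i> * of_real \<alpha> * \<beta> + \<beta>\<^sup>2 / l"
    unfolding k_def h_def using l0 by (simp add: field_simps power2_eq_square)
  finally have "\<Delta> l - (2 * \<i> * of_real \<alpha> * l * c - l * (1 + (of_real \<alpha>)\<^sup>2) * s) =
      e2 + k * e1 + 2 * \<beta> * c + 2 * \<i> * of_real \<alpha> * \<beta> * s + \<beta>\<^sup>2 / l * s"
    by (simp add: h_def algebra_simps)
  also have "norm \<dots> \<le> norm e2 + norm (k * e1) + norm (2 * \<beta> * c) + norm (2 * \<i> * of_real \<alpha> * \<beta> * s) + norm (\<beta>\<^sup>2 / l * s)"
    by (intro order_trans[OF norm_triangle_ineq] add_right_mono order_refl)
  also have "\<dots> \<le> 2 * B * Q * E + B * (2 * B * Q * E) + 2 * norm \<beta> * E + 2 * \<alpha> * norm \<beta> * E + (norm \<beta>)\<^sup>2 * E"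
  proof (intro add_mono e)
    show "norm (k * e1) \<le> B * (2 * B * Q * E)"
      unfolding norm_mult by (intro mult_mono k e) (use B_ge in auto)
    show "norm (2 * \<beta> * c) \<le> 2 * norm \<beta> * E" using sc by (simp add: norm_mult mult_left_mono)
    show "norm (2 * \<i> * of_real \<alpha> * \<beta> * s) \<le> 2 * \<alpha> * norm \<beta> * E"
      using sc \<alpha> by (simp add: norm_mult mult_left_mono)
    have "(norm \<beta>)\<^sup>2 / norm l \<le> (norm \<beta>)\<^sup>2"
      using l1 mult_left_mono[OF l1, of "(norm \<beta>)\<^sup>2"] by (subst pos_divide_le_eq) auto
    then show "norm (\<beta>\<^sup>2 / l * s) \<le> (norm \<beta>)\<^sup>2 * E"
      unfolding norm_mult norm_divide norm_power by (intro mult_mono sc) auto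
  qed
  also have "\<dots> = err * E" by (simp add: err_def algebra_simps)
  finally show ?thesis unfolding main E_def .
qed

text \<open>Outside this radius the error is at most half of the lower bound for the leading part.\<close>

definition R1 :: real where "R1 = R + err / \<alpha>"

lemma norm_exp_il:
  "norm (exp (\<i> * l * of_real a)) \<le> exp (\<bar>Im l\<bar> * a)" "norm (exp (- (\<i> * l * of_real a))) \<le> exp (\<bar>Im l\<bar> * a)"
  using mult_right_mono[of "Im l" "\<bar>Im l\<bar>" a] mult_right_mono[of "- Im l" "\<bar>Im l\<bar>" a] a
  by (simp_all add: norm_exp_eq_Re)

lemma \<Delta>_upper:
  assumes l: "norm l \<ge> R"
  shows "norm (\<Delta> l) \<le> (err + (1 + \<alpha>)\<^sup>2) * norm l * exp (\<bar>Im l\<bar> * a)"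
proof -
  define E where "E = exp (\<bar>Im l\<bar> * a)"
  define P where "P = (1 + of_real \<alpha>)\<^sup>2 * exp (\<i> * l * of_real a)"
  define N where "N = (1 - of_real \<alpha>)\<^sup>2 * exp (- (\<i> * l * of_real a))"
  have l1: "norm l \<ge> 1" using l Q_nonneg by (auto simp: R_def)
  have np: "norm (1 + of_real \<alpha> :: complex) = 1 + \<alpha>" "norm (1 - of_real \<alpha> :: complex) = \<bar>1 - \<alpha>\<bar>"
    using \<alpha> by (metis abs_of_pos add_pos_pos norm_of_real of_real_1 of_real_add zero_less_one)
      (metis norm_of_real of_real_1 of_real_diff)
  have P: "norm P \<le> (1 + \<alpha>)\<^sup>2 * E"
    unfolding P_def norm_mult norm_power np E_def by (intro mult_left_mono norm_exp_il) auto
  have "\<bar>1 - \<alpha>\<bar>\<^sup>2 \<le> (1 + \<alpha>)\<^sup>2" using \<alpha> by (intro power_mono) auto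
  then have N: "norm N \<le> (1 + \<alpha>)\<^sup>2 * E"
    unfolding N_def norm_mult norm_power np E_def by (intro mult_mono norm_exp_il) auto
  have "norm (P - N) \<le> 2 * (1 + \<alpha>)\<^sup>2 * E"
    using norm_triangle_ineq4[of P N] P N by linarith
  then have "norm l / 2 * norm (P - N) \<le> norm l / 2 * (2 * (1 + \<alpha>)\<^sup>2 * E)"
    by (intro mult_left_mono) auto
  then have "norm (\<i> * l / 2 * (P - N)) \<le> norm l / 2 * (2 * (1 + \<alpha>)\<^sup>2 * E)"
    by (simp add: norm_mult norm_divide)
  moreover have "norm (\<Delta> l - \<i> * l / 2 * (P - N)) \<le> err * E"
    using \<Delta>_asymptotics[OF l] by (simp add: P_def N_def E_def)
  moreover have "err * E \<le> norm l * (err * E)"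
    using mult_right_mono[OF l1, of "err * E"] err_nonneg by (simp add: E_def)
  moreover have "norm (\<Delta> l) \<le> norm (\<Delta> l - \<i> * l / 2 * (P - N)) + norm (\<i> * l / 2 * (P - N))"
    using norm_triangle_ineq[of "\<Delta> l - \<i> * l / 2 * (P - N)" "\<i> * l / 2 * (P - N)"] by simp
  ultimately show ?thesis by (simp add: E_def algebra_simps)
qed

text \<open>In the closed lower half-plane \<open>e\<^sup>i\<^sup>l\<^sup>a\<close> is the dominant exponential and has the larger coefficient, and
  \<open>(1 + \<alpha>)\<^sup>2 - (1 - \<alpha>)\<^sup>2 = 4 \<alpha>\<close>. No such bound holds in the upper half-plane: there the leading part has
  zeros or, for \<open>\<alpha> = 1\<close>, decays.\<close>

lemma \<Delta>_lower:
  assumes l: "norm l \<ge> R1" and im: "Im l \<le> 0"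
  shows "norm (\<Delta> l) \<ge> \<alpha> * norm l * exp (\<bar>Im l\<bar> * a)"
proof -
  define E where "E = exp (\<bar>Im l\<bar> * a)"
  define P where "P = (1 + of_real \<alpha>)\<^sup>2 * exp (\<i> * l * of_real a)"
  define N where "N = (1 - of_real \<alpha>)\<^sup>2 * exp (- (\<i> * l * of_real a))"
  have ea: "err / \<alpha> \<ge> 0" using err_nonneg \<alpha> by simp
  have lR: "norm l \<ge> R" using l ea by (simp add: R1_def)
  have "R \<ge> 0" using Q_nonneg by (simp add: R_def)
  then have "err / \<alpha> \<le> norm l" using l by (simp add: R1_def)
  then have la: "err \<le> \<alpha> * norm l" using \<alpha> by (simp add: pos_divide_le_eq mult.commute)
  have np: "norm (1 + of_real \<alpha> :: complex) = 1 + \<alpha>" "norm (1 - of_real \<alpha> :: complex) = \<bar>1 - \<alpha>\<bar>"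
    using \<alpha> by (metis abs_of_pos add_pos_pos norm_of_real of_real_1 of_real_add zero_less_one)
      (metis norm_of_real of_real_1 of_real_diff)
  have P: "norm P = (1 + \<alpha>)\<^sup>2 * E"
    unfolding P_def norm_mult norm_power np E_def using im by (simp add: norm_exp_eq_Re)
  have N: "norm N \<le> \<bar>1 - \<alpha>\<bar>\<^sup>2 * E"
    unfolding N_def norm_mult norm_power np E_def by (intro mult_left_mono norm_exp_il) auto
  have "(1 + \<alpha>)\<^sup>2 - \<bar>1 - \<alpha>\<bar>\<^sup>2 = 4 * \<alpha>" by (simp add: power2_eq_square algebra_simps)
  then have "(1 + \<alpha>)\<^sup>2 * E - \<bar>1 - \<alpha>\<bar>\<^sup>2 * E = 4 * \<alpha> * E" by (simp flip: left_diff_distrib)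
  then have "4 * \<alpha> * E \<le> norm (P - N)"
    using P N norm_triangle_ineq2[of P N] by linarith
  then have "norm l / 2 * (4 * \<alpha> * E) \<le> norm l / 2 * norm (P - N)"
    by (intro mult_left_mono) auto
  then have "norm l / 2 * (4 * \<alpha> * E) \<le> norm (\<i> * l / 2 * (P - N))"
    by (simp add: norm_mult norm_divide)
  moreover have "norm (\<Delta> l - \<i> * l / 2 * (P - N)) \<le> err * E"
    using \<Delta>_asymptotics[OF lR] by (simp add: P_def N_def E_def)
  moreover have "err * E \<le> \<alpha> * norm l * E" using la by (simp add: E_def)
  moreover have "norm (\<i> * l / 2 * (P - N)) \<le> norm (\<Delta> l) + norm (\<Delta> l - \<i> * l / 2 * (P - N))"
    using norm_triangle_ineq4[of "\<Delta> l" "\<Delta> l - \<i> * l / 2 * (P - N)"] by simp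
  moreover have "norm l / 2 * (4 * \<alpha> * E) = 2 * (\<alpha> * norm l * E)" by simp
  ultimately show ?thesis unfolding E_def[symmetric] by linarith
qed

lemma \<Delta>_exponential_type:
  obtains C where "\<And>l. norm (\<Delta> l) \<le> C * exp ((1 + a) * norm l)"
proof -
  have "bounded (\<Delta> ` cball 0 R)"
    using holomorphic_\<Delta>
    by (intro compact_imp_bounded compact_continuous_image)
       (auto intro: holomorphic_on_imp_continuous_on holomorphic_on_subset)
  then obtain M where M: "M > 0" "\<And>y. y \<in> \<Delta> ` cball 0 R \<Longrightarrow> norm y \<le> M" unfolding bounded_pos by auto
  define C where "C = M + (err + (1 + \<alpha>)\<^sup>2)"
  have C: "M \<le> C" "err + (1 + \<alpha>)\<^sup>2 \<le> C" "C \<ge> 0" using M(1) err_nonneg by (simp_all add: C_def)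
  have "norm (\<Delta> l) \<le> C * exp ((1 + a) * norm l)" for l
  proof (cases "norm l \<ge> R")
    case True
    have "norm (\<Delta> l) \<le> (err + (1 + \<alpha>)\<^sup>2) * norm l * exp (\<bar>Im l\<bar> * a)" by (rule \<Delta>_upper[OF True])
    also have "\<dots> \<le> C * exp (norm l) * exp (a * norm l)"
    proof (intro mult_mono C)
      show "norm l \<le> exp (norm l)" using exp_ge_add_one_self[of "norm l"] by linarith
      show "exp (\<bar>Im l\<bar> * a) \<le> exp (a * norm l)"
        using mult_right_mono[OF abs_Im_le_cmod[of l], of a] a by (simp add: mult.commute)
    qed (use C in auto)
    also have "\<dots> = C * exp ((1 + a) * norm l)" by (simp add: exp_add[symmetric] algebra_simps)
    finally show ?thesis .
  next
    case False
    then have "norm (\<Delta> l) \<le> M" by (intro M) auto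
    also have "\<dots> \<le> C * 1" using C by simp
    also have "\<dots> \<le> C * exp ((1 + a) * norm l)" using C a by (intro mult_left_mono) auto
    finally show ?thesis .
  qed
  then show ?thesis by (rule that)
qed

text \<open>On the imaginary axis \<open>l = i t\<close> the cosine becomes \<open>cosh (t x)\<close>, which has no zeros. This is where
  \<open>A\<close> and \<open>D\<close> of two problems, and later the solutions themselves, are compared.\<close>

lemma imaginary_axis:
  assumes t: "t \<ge> R" and x: "x \<in> {0..a}"
  shows "norm (val (- (of_real t)\<^sup>2) 1 \<beta> x - of_real (cosh (t * x))) \<le> (2 * B * Q + norm \<beta>) / t * exp (t * x)"
    "norm (der (- (of_real t)\<^sup>2) 1 \<beta> x - of_real (t * sinh (t * x))) \<le> (2 * B * Q + norm \<beta>) * exp (t * x)"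
proof -
  define l where "l = \<i> * of_real t"
  have t1: "t \<ge> 1" using t Q_nonneg by (simp add: R_def)
  have l2: "l\<^sup>2 = - (of_real t)\<^sup>2" by (simp add: l_def power_mult_distrib)
  have nl: "norm l = t" "\<bar>Im l\<bar> = t" using t1 by (simp_all add: l_def norm_mult)
  have lR: "norm l \<ge> R" using t nl by simp
  have "norm \<beta> \<le> B - 1" "B - 1 \<ge> 0" using \<alpha> by (simp_all add: B_def)
  then have d: "norm \<beta> \<le> norm l * (B - 1)" using mult_right_mono[OF t1, of "B - 1"] nl by simp
  have lx: "l * of_real x = \<i> * of_real (t * x)" by (simp add: l_def)
  have "cosh (complex_of_real r) = of_real (cosh r)" "sinh (complex_of_real r) = of_real (sinh r)" for r
    by (simp_all add: cosh_field_def sinh_field_def exp_of_real flip: of_real_minus)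
  then have c: "cos (l * of_real x) = of_real (cosh (t * x))"
    and s: "sin (l * of_real x) = \<i> * of_real (sinh (t * x))"
    using cosh_conv_cos[of "complex_of_real (t * x)"] sinh_conv_sin[of "complex_of_real (t * x)"]
    unfolding lx by (simp_all add: mult.assoc[symmetric] del: of_real_mult)
  note n = norm_sin_cos_le_exp_Im[of x l, unfolded nl]
  have x0: "x \<ge> 0" using x by simp
  note as = asymptotics(2,3)[OF lR d x, unfolded nl l2]
  define u where "u = val (- (of_real t)\<^sup>2) 1 \<beta> x"
  define v where "v = der (- (of_real t)\<^sup>2) 1 \<beta> x"
  have "norm (l * (u - of_real (cosh (t * x)))) \<le> norm (l * u - (\<beta> * sin (l * of_real x) + l * cos (l * of_real x))) + norm (\<beta> * sin (l * of_real x))"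
    using norm_triangle_ineq[of "l * u - (\<beta> * sin (l * of_real x) + l * cos (l * of_real x))" "\<beta> * sin (l * of_real x)"]
    by (simp add: c algebra_simps)
  also have "\<dots> \<le> 2 * B * Q * exp (t * x) + norm \<beta> * exp (t * x)"
    unfolding u_def norm_mult[of \<beta>] by (intro add_mono as mult_left_mono n x0) auto
  finally have "t * norm (u - of_real (cosh (t * x))) \<le> (2 * B * Q + norm \<beta>) * exp (t * x)"
    unfolding norm_mult nl by (simp add: algebra_simps)
  then show "norm (val (- (of_real t)\<^sup>2) 1 \<beta> x - of_real (cosh (t * x))) \<le> (2 * B * Q + norm \<beta>) / t * exp (t * x)"
    using t1 by (simp add: u_def field_simps)
  have ls: "l * sin (l * of_real x) = - of_real (t * sinh (t * x))" unfolding s by (simp add: l_def algebra_simps)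
  have "norm (v - of_real (t * sinh (t * x))) \<le> norm (v - (\<beta> * cos (l * of_real x) - l * sin (l * of_real x))) + norm (\<beta> * cos (l * of_real x))"
    using norm_triangle_ineq[of "v - (\<beta> * cos (l * of_real x) - l * sin (l * of_real x))" "\<beta> * cos (l * of_real x)"]
    by (simp add: ls algebra_simps)
  also have "\<dots> \<le> 2 * B * Q * exp (t * x) + norm \<beta> * exp (t * x)"
    unfolding v_def norm_mult[of \<beta>] by (intro add_mono as mult_left_mono n x0) auto
  finally show "norm (der (- (of_real t)\<^sup>2) 1 \<beta> x - of_real (t * sinh (t * x))) \<le> (2 * B * Q + norm \<beta>) * exp (t * x)"
    by (simp add: v_def algebra_simps)
qed

lemma A_tendsto: "((\<lambda>t. A (- (of_real t)\<^sup>2) * of_real (2 * exp (- (t * a)))) \<longlongrightarrow> 1) at_top"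
proof -
  define K where "K = 2 * B * Q + norm \<beta>"
  have aa: "a \<in> {0..a}" using a by simp
  have lim: "((\<lambda>t. 2 * K / t + exp (- (2 * t * a))) \<longlongrightarrow> 0) at_top" using a by real_asymp
  have bound: "\<forall>\<^sub>F t in at_top. norm (A (- (of_real t)\<^sup>2) * of_real (2 * exp (- (t * a))) - 1) \<le> 2 * K / t + exp (- (2 * t * a))"
    using eventually_ge_at_top[of R]
  proof eventually_elim
    case (elim t)
    define e where "e = A (- (of_real t)\<^sup>2) - of_real (cosh (t * a))"
    have e: "norm e \<le> K / t * exp (t * a)"
      using imaginary_axis(1)[OF elim aa] by (simp add: e_def A_def K_def)
    have ch: "cosh (t * a) * (2 * exp (- (t * a))) = 1 + exp (- (2 * t * a))"
      by (simp add: cosh_def algebra_simps flip: exp_add)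
    have "A (- (of_real t)\<^sup>2) * of_real (2 * exp (- (t * a))) - 1
        = e * of_real (2 * exp (- (t * a))) + of_real (cosh (t * a) * (2 * exp (- (t * a))) - 1)"
      by (simp add: e_def algebra_simps)
    also have "norm \<dots> \<le> norm (e * of_real (2 * exp (- (t * a)))) + norm (complex_of_real (cosh (t * a) * (2 * exp (- (t * a))) - 1))"
      by (rule norm_triangle_ineq)
    also have "\<dots> = norm e * (2 * exp (- (t * a))) + exp (- (2 * t * a))"
      unfolding ch by (simp add: norm_mult del: of_real_add of_real_diff of_real_exp)
    also have "norm e * (2 * exp (- (t * a))) \<le> K / t * exp (t * a) * (2 * exp (- (t * a)))"
      by (intro mult_right_mono e) auto
    also have "\<dots> = 2 * K / t" by (simp add: exp_minus)
    finally show ?case by simp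
  qed
  show ?thesis by (rule LIM_zero_cancel[OF Lim_null_comparison[OF bound lim]])
qed

lemma D_tendsto: "((\<lambda>t. D (- (of_real t)\<^sup>2) * of_real (2 * exp (- (t * a)) / t)) \<longlongrightarrow> 1) at_top"
proof -
  define K where "K = 2 * B * Q + norm \<beta>"
  have aa: "a \<in> {0..a}" using a by simp
  have lim: "((\<lambda>t. 2 * K / t + exp (- (2 * t * a))) \<longlongrightarrow> 0) at_top" using a by real_asymp
  have bound: "\<forall>\<^sub>F t in at_top. norm (der (- (of_real t)\<^sup>2) 1 \<beta> a * of_real (2 * exp (- (t * a)) / t) - 1) \<le> 2 * K / t + exp (- (2 * t * a))"
    using eventually_ge_at_top[of R]
  proof eventually_elim
    case (elim t)
    have t1: "t \<ge> 1" using elim Q_nonneg by (simp add: R_def)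
    define e where "e = der (- (of_real t)\<^sup>2) 1 \<beta> a - of_real (t * sinh (t * a))"
    have e: "norm e \<le> K * exp (t * a)"
      using imaginary_axis(2)[OF elim aa] by (simp add: e_def K_def)
    have "sinh (t * a) * (2 * exp (- (t * a))) = 1 - exp (- (2 * t * a))"
      by (simp add: sinh_def algebra_simps flip: exp_add)
    then have ch: "t * sinh (t * a) * (2 * exp (- (t * a)) / t) = 1 - exp (- (2 * t * a))"
      using t1 by simp
    have "der (- (of_real t)\<^sup>2) 1 \<beta> a * of_real (2 * exp (- (t * a)) / t) - 1
        = e * of_real (2 * exp (- (t * a)) / t) + of_real (t * sinh (t * a) * (2 * exp (- (t * a)) / t) - 1)"
      by (simp add: e_def algebra_simps)
    also have "norm \<dots> \<le> norm (e * of_real (2 * exp (- (t * a)) / t)) + norm (complex_of_real (t * sinh (t * a) * (2 * exp (- (t * a)) / t) - 1))"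
      by (rule norm_triangle_ineq)
    also have "\<dots> = norm e * (2 * exp (- (t * a)) / t) + exp (- (2 * t * a))"
      unfolding ch using t1 by (simp add: norm_mult norm_divide)
    also have "norm e * (2 * exp (- (t * a)) / t) \<le> K * exp (t * a) * (2 * exp (- (t * a)) / t)"
      using t1 by (intro mult_right_mono e) auto
    also have "\<dots> = 2 * K / t" by (simp add: exp_minus)
    finally show ?case by simp
  qed
  have 1: "((\<lambda>t. der (- (of_real t)\<^sup>2) 1 \<beta> a * of_real (2 * exp (- (t * a)) / t)) \<longlongrightarrow> 1) at_top"
    by (rule LIM_zero_cancel[OF Lim_null_comparison[OF bound lim]])
  have "((\<lambda>t::real. complex_of_real (1 / t)) \<longlongrightarrow> of_real 0) at_top"
    by (intro tendsto_of_real) real_asymp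
  from tendsto_add[OF 1 tendsto_mult[OF tendsto_mult[OF tendsto_const[of \<beta>] A_tendsto] this]]
  show ?thesis by (simp add: D_def algebra_simps)
qed

end

section \<open>Two symmetric problems with the same eigenvalues\<close>

text \<open>This removes the exponential factor: applied along the rays through \<open>1\<close> and \<open>-i\<close> it yields the real and
  the imaginary part of \<open>b\<close> in \<open>exp (b l + c)\<close>.\<close>

lemma slope_zero_if_exp_bounded:
  fixes r s :: real
  assumes L: "L > 0" and b: "\<And>t. t \<ge> T \<Longrightarrow> L \<le> exp (r * t + s) \<and> exp (r * t + s) \<le> U"
  shows "r = 0"
proof (rule ccontr)
  assume r: "r \<noteq> 0"
  have U: "U > 0" using b[of T] L by linarith
  define M where "M = \<bar>ln U\<bar> + \<bar>ln L\<bar> + \<bar>s\<bar> + 1"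
  define t where "t = max T (M / \<bar>r\<bar>)"
  have "exp (r * t + s) \<le> exp (ln U)" "exp (ln L) \<le> exp (r * t + s)"
    using b[of t] U L by (auto simp: t_def)
  then have "r * t + s \<le> ln U" "ln L \<le> r * t + s" by simp_all
  then have "\<bar>r * t\<bar> < M" unfolding M_def by linarith
  moreover have "M / \<bar>r\<bar> \<le> t" by (simp add: t_def)
  then have "M \<le> \<bar>r\<bar> * t" using r by (simp add: pos_divide_le_eq mult.commute)
  then have "M \<le> \<bar>r * t\<bar>" using mult_left_mono[OF abs_ge_self[of t] abs_ge_zero[of r]] by (simp add: abs_mult)
  ultimately show False by simp
qed

locale isospectral_pair =
  P: symmetric_problem a q \<alpha> \<beta> + P': symmetric_problem a q' \<alpha>' \<beta>'
  for a :: real and q :: "real \<Rightarrow> complex" and \<alpha> :: real and \<beta> :: complex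
    and q' :: "real \<Rightarrow> complex" and \<alpha>' :: real and \<beta>' :: complex +
  assumes \<Delta>0: "P.\<Delta> 0 \<noteq> 0"
    and zeros: "P.\<Delta> l = 0 \<longleftrightarrow> P'.\<Delta> l = 0"
    and mult: "P.\<Delta> l = 0 \<Longrightarrow> zorder P.\<Delta> l = zorder P'.\<Delta> l"
begin

text \<open>Equal zeros and orders give a zero-free entire quotient, which is \<open>exp (b l + c)\<close> as both functions
  are of exponential type. In the lower half-plane both have size \<open>|l| e\<^bsup>|Im l| a\<^esup>\<close> up to constants,
  which leaves no room for \<open>b\<close>.\<close>

lemma \<Delta>_proportional: "\<exists>K. K \<noteq> 0 \<and> (\<forall>l. P'.\<Delta> l = K * P.\<Delta> l)"
proof -
  have ana: "P.\<Delta> analytic_on {z}" "P'.\<Delta> analytic_on {z}" for z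
    using P.holomorphic_\<Delta> P'.holomorphic_\<Delta> by (auto simp: analytic_on_open intro: analytic_on_subset[of _ UNIV])
  have z: "zorder P.\<Delta> l = zorder P'.\<Delta> l" for l
  proof (cases "P.\<Delta> l = 0")
    case False
    then have "P'.\<Delta> l \<noteq> 0" using zeros by blast
    then show ?thesis using False zorder_eq_0I ana by metis
  qed (rule mult)
  obtain F where F: "F holomorphic_on UNIV" "\<And>z. F z \<noteq> 0" "\<And>z. P'.\<Delta> z = F z * P.\<Delta> z"
    using holomorphic_zorder_factorization[OF P'.holomorphic_\<Delta> open_UNIV connected_UNIV P.holomorphic_\<Delta> zeros z]
    by auto
  obtain C where C: "\<And>l. norm (P.\<Delta> l) \<le> C * exp ((1 + a) * norm l)" using P.\<Delta>_exponential_type by blast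
  obtain C' where C': "\<And>l. norm (P'.\<Delta> l) \<le> C' * exp ((1 + a) * norm l)" using P'.\<Delta>_exponential_type by blast
  have "C * exp ((1 + a) * norm z) \<le> max C C' * exp ((1 + a) * norm z)"
    "C' * exp ((1 + a) * norm z) \<le> max C C' * exp ((1 + a) * norm z)" for z :: complex
    by (intro mult_right_mono; simp)+
  then have "norm (P.\<Delta> z) \<le> max C C' * exp ((1 + a) * norm z)"
    "norm (P.\<Delta> z * F z) \<le> max C C' * exp ((1 + a) * norm z)" for z
    using order_trans[OF C[of z]] order_trans[OF C'[of z]] F(3)[of z] by (simp_all add: mult.commute)
  then obtain b c where bc: "\<And>z. F z = exp (b * z + c)"
    using zero_free_quotient_of_exponential_type[OF P.holomorphic_\<Delta> F(1) \<Delta>0 F(2)] by metis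
  define U where "U = (P'.err + (1 + \<alpha>')\<^sup>2) / \<alpha>"
  define L where "L = \<alpha>' / (P.err + (1 + \<alpha>)\<^sup>2)"
  have pos: "P.err + (1 + \<alpha>)\<^sup>2 > 0" using P.err_nonneg P.\<alpha> by (simp add: add_nonneg_pos)
  have L0: "L > 0" using pos P'.\<alpha> by (simp add: L_def)
  have Fb: "L \<le> norm (F l) \<and> norm (F l) \<le> U" if l: "norm l \<ge> max P.R1 P'.R1" and im: "Im l \<le> 0" for l
  proof -
    define m where "m = norm l * exp (\<bar>Im l\<bar> * a)"
    have R: "P.R1 \<ge> P.R" "P'.R1 \<ge> P'.R" "P.R \<ge> 1"
      using P.err_nonneg P.\<alpha> P'.err_nonneg P'.\<alpha> P.Q_nonneg by (simp_all add: P.R1_def P'.R1_def P.R_def)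
    have m: "m > 0" using l R unfolding m_def by (intro mult_pos_pos) auto
    have 1: "\<alpha> * m \<le> norm (P.\<Delta> l)" "\<alpha>' * m \<le> norm (P'.\<Delta> l)"
      using P.\<Delta>_lower[of l] P'.\<Delta>_lower[of l] l im by (simp_all add: m_def mult.assoc)
    have 2: "norm (P.\<Delta> l) \<le> (P.err + (1 + \<alpha>)\<^sup>2) * m" "norm (P'.\<Delta> l) \<le> (P'.err + (1 + \<alpha>')\<^sup>2) * m"
      using P.\<Delta>_upper[of l] P'.\<Delta>_upper[of l] l R by (simp_all add: m_def mult.assoc)
    have eq: "norm (P'.\<Delta> l) = norm (F l) * norm (P.\<Delta> l)" by (simp add: F(3) norm_mult)
    have "norm (F l) * (\<alpha> * m) \<le> norm (P'.\<Delta> l)" unfolding eq by (intro mult_left_mono 1) auto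
    then have "(norm (F l) * \<alpha>) * m \<le> (P'.err + (1 + \<alpha>')\<^sup>2) * m" using 2 by (simp add: mult.assoc)
    then have "norm (F l) * \<alpha> \<le> P'.err + (1 + \<alpha>')\<^sup>2" using m by simp
    then have "norm (F l) \<le> U" using P.\<alpha> by (simp add: U_def pos_le_divide_eq)
    moreover have "norm (P'.\<Delta> l) \<le> norm (F l) * ((P.err + (1 + \<alpha>)\<^sup>2) * m)"
      unfolding eq by (intro mult_left_mono 2) auto
    then have "\<alpha>' * m \<le> (norm (F l) * (P.err + (1 + \<alpha>)\<^sup>2)) * m" using 1 by (simp add: mult.assoc)
    then have "\<alpha>' \<le> norm (F l) * (P.err + (1 + \<alpha>)\<^sup>2)" using m by simp
    then have "L \<le> norm (F l)" using pos by (simp add: L_def pos_divide_le_eq)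
    ultimately show ?thesis by blast
  qed
  have slope: "Re (b * w) = 0" if w: "norm w = 1" "Im w \<le> 0" for w
  proof (rule slope_zero_if_exp_bounded[OF L0])
    fix t assume t: "t \<ge> max 0 (max P.R1 P'.R1)"
    have "norm (of_real t * w) \<ge> max P.R1 P'.R1" using t w by (simp add: norm_mult)
    moreover have "Im (of_real t * w) \<le> 0" using t w by (simp add: mult_nonneg_nonpos)
    moreover have "norm (F (of_real t * w)) = exp (Re (b * w) * t + Re c)"
      by (simp add: bc norm_exp_eq_Re algebra_simps)
    ultimately show "L \<le> exp (Re (b * w) * t + Re c) \<and> exp (Re (b * w) * t + Re c) \<le> U"
      using Fb[of "of_real t * w"] by simp
  qed
  have "b = 0" using slope[of 1] slope[of "-\<i>"] by (simp add: complex_eq_iff)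
  then have "P'.\<Delta> l = exp c * P.\<Delta> l" for l using F(3) bc by simp
  then show ?thesis by (intro exI[of _ "exp c"]) auto
qed

text \<open>Odd and even parts of \<open>\<Delta>' = K \<Delta>\<close> are compared separately. With \<open>T = - \<alpha>\<^sup>2 z S\<close>, sum and product of
  \<open>D'\<close> and \<open>T'\<close> are those of \<open>K D\<close> and \<open>K T\<close>, so \<open>(D' - K D) (D' - K T) = 0\<close>; the value at \<open>0\<close> decides
  which factor vanishes identically.\<close>

lemma invariants_eq: "\<alpha>' = \<alpha> \<and> (\<forall>z. z \<noteq> 0 \<longrightarrow> P'.A z = P.A z \<and> P'.S z = P.S z) \<and> (\<forall>l. P'.\<Delta> l = P.\<Delta> l)"
proof -
  obtain K where K: "K \<noteq> 0" "\<And>l. P'.\<Delta> l = K * P.\<Delta> l" using \<Delta>_proportional by blast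
  have odd: "of_real \<alpha>' * P'.A z = K * of_real \<alpha> * P.A z"
    and even: "P'.D z - (of_real \<alpha>')\<^sup>2 * z * P'.S z = K * (P.D z - (of_real \<alpha>)\<^sup>2 * z * P.S z)" if z: "z \<noteq> 0" for z
  proof -
    obtain l where l: "z = l\<^sup>2" by (metis power2_csqrt)
    have l0: "l \<noteq> 0" using z l by auto
    have 1: "P'.D z + 2 * \<i> * of_real \<alpha>' * l * P'.A z - (of_real \<alpha>')\<^sup>2 * z * P'.S z =
       K * (P.D z + 2 * \<i> * of_real \<alpha> * l * P.A z - (of_real \<alpha>)\<^sup>2 * z * P.S z)"
      using K(2)[of l] unfolding P.\<Delta>_eq P'.\<Delta>_eq by (simp add: l)
    have 2: "P'.D z - 2 * \<i> * of_real \<alpha>' * l * P'.A z - (of_real \<alpha>')\<^sup>2 * z * P'.S z =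
       K * (P.D z - 2 * \<i> * of_real \<alpha> * l * P.A z - (of_real \<alpha>)\<^sup>2 * z * P.S z)"
      using K(2)[of "-l"] unfolding P.\<Delta>_eq P'.\<Delta>_eq by (simp add: l)
    have "(4 * \<i> * l) * (of_real \<alpha>' * P'.A z) = (4 * \<i> * l) * (K * of_real \<alpha> * P.A z)"
      using 1 2 by algebra
    then show "of_real \<alpha>' * P'.A z = K * of_real \<alpha> * P.A z" using l0 by simp
    have "2 * (P'.D z - (of_real \<alpha>')\<^sup>2 * z * P'.S z) = 2 * (K * (P.D z - (of_real \<alpha>)\<^sup>2 * z * P.S z))"
      using 1 2 by algebra
    then show "P'.D z - (of_real \<alpha>')\<^sup>2 * z * P'.S z = K * (P.D z - (of_real \<alpha>)\<^sup>2 * z * P.S z)"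
      unfolding mult_cancel_left by simp
  qed
  have z0: "- (complex_of_real t)\<^sup>2 \<noteq> 0" if "t > 0" for t using that by simp
  have \<alpha>K: "complex_of_real \<alpha>' = K * of_real \<alpha>"
  proof -
    have lim1: "((\<lambda>t. of_real \<alpha>' * (P'.A (- (of_real t)\<^sup>2) * of_real (2 * exp (- (t * a))))) \<longlongrightarrow> of_real \<alpha>' * 1) at_top"
      by (intro tendsto_mult tendsto_const P'.A_tendsto)
    have lim2: "((\<lambda>t. K * of_real \<alpha> * (P.A (- (of_real t)\<^sup>2) * of_real (2 * exp (- (t * a))))) \<longlongrightarrow> K * of_real \<alpha> * 1) at_top"
      by (intro tendsto_mult[OF tendsto_const] P.A_tendsto)
    have ev: "\<forall>\<^sub>F t in at_top. of_real \<alpha>' * (P'.A (- (of_real t)\<^sup>2) * of_real (2 * exp (- (t * a))))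
       = K * of_real \<alpha> * (P.A (- (of_real t)\<^sup>2) * of_real (2 * exp (- (t * a))))"
      using eventually_gt_at_top[of 0] by eventually_elim (simp only: mult.assoc[symmetric] odd[OF z0])
    show ?thesis
      using tendsto_unique[OF trivial_limit_at_top_linorder iffD1[OF tendsto_cong[OF ev] lim1] lim2] by simp
  qed
  have A: "P'.A z = P.A z" if "z \<noteq> 0" for z
  proof -
    have "complex_of_real \<alpha>' \<noteq> 0" using P'.\<alpha> by simp
    then show ?thesis using odd[OF that] unfolding \<alpha>K[symmetric] by simp
  qed
  have prod: "(P'.D z - K * P.D z) * (P'.D z + K * ((of_real \<alpha>)\<^sup>2 * z * P.S z)) = 0" if z: "z \<noteq> 0" for z
    using even[OF z] A[OF z] P.A_sq[of z] P'.A_sq[of z] unfolding \<alpha>K by algebra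
  define f where "f z = P'.D z - K * P.D z" for z
  have f: "f holomorphic_on UNIV" unfolding f_def
    by (intro holomorphic_intros P.holomorphic_ASD P'.holomorphic_ASD)
  have D: "f z = 0" for z
  proof -
    \<comment> \<open>\<open>g = D' - K T\<close>; it is nonzero at \<open>0\<close>, where \<open>T\<close> vanishes and \<open>D'\<close> equals \<open>\<Delta>'\<close>.\<close>
    define g where "g z = P'.D z + K * ((of_real \<alpha>)\<^sup>2 * z * P.S z)" for z
    have "g holomorphic_on UNIV" unfolding g_def
      by (intro holomorphic_intros P.holomorphic_ASD P'.holomorphic_ASD)
    then have "continuous_on UNIV g" by (rule holomorphic_on_imp_continuous_on)
    then have cont: "isCont g 0" by (simp add: continuous_on_eq_continuous_at)
    have "P'.\<Delta> 0 = P'.D 0" unfolding P'.\<Delta>_eq by simp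
    then have "g 0 \<noteq> 0" using K(1) K(2)[of 0] \<Delta>0 unfolding g_def by (metis add_0_right mult_eq_0_iff mult_zero_left mult_zero_right)
    then obtain e where e: "e > 0" "\<And>w. dist 0 w < e \<Longrightarrow> g w \<noteq> 0"
      using continuous_at_avoid[OF cont] by blast
    show ?thesis
    proof (rule analytic_continuation[OF f open_UNIV connected_UNIV subset_UNIV UNIV_I])
      show "(0::complex) islimpt (ball 0 e - {0})"
        using e(1) by (simp add: islimpt_ball islimpt_punctured[symmetric])
      show "f w = 0" if "w \<in> ball 0 e - {0}" for w
        using prod[of w] e(2)[of w] that by (auto simp: f_def g_def)
    qed auto
  qed
  have K1: "K = 1"
  proof -
    have "((\<lambda>t. K * (P.D (- (of_real t)\<^sup>2) * of_real (2 * exp (- (t * a)) / t))) \<longlongrightarrow> K * 1) at_top"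
      by (intro tendsto_mult[OF tendsto_const] P.D_tendsto)
    moreover have "K * (P.D w * c) = P'.D w * c" for w c using D[of w] by (simp add: f_def)
    ultimately have "((\<lambda>t. P'.D (- (of_real t)\<^sup>2) * of_real (2 * exp (- (t * a)) / t)) \<longlongrightarrow> K * 1) at_top"
      by simp
    from tendsto_unique[OF trivial_limit_at_top_linorder this P'.D_tendsto] show ?thesis by simp
  qed
  have \<alpha>: "\<alpha>' = \<alpha>" using \<alpha>K by (simp add: K1)
  have S: "P'.S z = P.S z" if z: "z \<noteq> 0" for z
  proof -
    have "(of_real \<alpha>)\<^sup>2 * z \<noteq> (0::complex)" using z P.\<alpha> by simp
    moreover have "(of_real \<alpha>)\<^sup>2 * z * P'.S z = (of_real \<alpha>)\<^sup>2 * z * P.S z"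
      using even[OF z] D[of z] by (simp add: f_def K1 \<alpha>)
    ultimately show ?thesis by simp
  qed
  show ?thesis using \<alpha> A S K(2) K1 by simp
qed

text \<open>Let \<open>G\<close> be the left hand side and \<open>y\<close>, \<open>y'\<close> the solutions of the two problems satisfying the condition at \<open>0\<close>.
  Since \<open>\<Delta>\<close> and \<open>y(a)\<close> are common, the reflection formula gives
  \<open>\<Delta> G = y(a - x) y'(x) - y(x) y'(a - x)\<close>, of size \<open>e\<^bsup>|Im l| a\<^esup>\<close>. Dividing by \<open>\<Delta>\<close> in the lower half-plane,
  and using that \<open>G\<close> is even, \<open>G\<close> tends to \<open>0\<close> at infinity, so it is \<open>0\<close> by Liouville.\<close>

lemma cross_product_vanishes:
  assumes x: "x \<in> {0..a}"
  shows "P.val (l\<^sup>2) 1 \<beta> x * P'.val (l\<^sup>2) 0 1 x - P.val (l\<^sup>2) 0 1 x * P'.val (l\<^sup>2) 1 \<beta>' x = 0"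
proof -
  define G where "G l = P.val (l\<^sup>2) 1 \<beta> x * P'.val (l\<^sup>2) 0 1 x - P.val (l\<^sup>2) 0 1 x * P'.val (l\<^sup>2) 1 \<beta>' x" for l
  define C where "C = 8 * P.B * P'.B / \<alpha>"
  have C0: "C \<ge> 0" using P.B_ge P'.B_ge P.\<alpha> by (simp add: C_def)
  have aa: "a \<in> {0..a}" and ax: "a - x \<in> {0..a}" using x by auto
  note inv = invariants_eq
  have R: "P.R1 \<ge> P.R" "P'.R1 \<ge> P'.R" "P.R \<ge> 1"
    using P.err_nonneg P.\<alpha> P'.err_nonneg P'.\<alpha> P.Q_nonneg by (simp_all add: P.R1_def P'.R1_def P.R_def)
  have lower: "norm (G l) \<le> C / norm l" if l: "norm l \<ge> max P.R1 P'.R1" and im: "Im l \<le> 0" for l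
  proof -
    have l0: "l \<noteq> 0" "norm l > 0" using l R by auto
    have lR: "norm l \<ge> P.R" "norm l \<ge> P'.R" using l R by auto
    define y where "y = P.val (l\<^sup>2) 1 (P.h l)"
    define y' where "y' = P'.val (l\<^sup>2) 1 (P'.h l)"
    define s where "s = P.val (l\<^sup>2) 0 1 x"
    define s' where "s' = P'.val (l\<^sup>2) 0 1 x"
    have ya: "y a = y' a"
      unfolding y_def y'_def P.val_h[OF aa] P'.val_h[OF aa]
      using inv l0 by (simp add: P.A_def P'.A_def P.S_def P'.S_def)
    have \<alpha>: "\<alpha>' = \<alpha>" and \<Delta>: "P'.\<Delta> l = P.\<Delta> l" using inv by blast+
    have "P'.\<Delta> l * s' = y' a * y' x - y' (a - x)"
      using P'.reflected_val[OF x, of l] by (simp add: s'_def y'_def)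
    moreover have "P.\<Delta> l * s = y a * y x - y (a - x)"
      using P.reflected_val[OF x, of l] by (simp add: s_def y_def)
    ultimately have 1: "P.\<Delta> l * s = y a * y x - y (a - x)" "P.\<Delta> l * s' = y a * y' x - y' (a - x)"
      unfolding ya \<Delta> by simp_all
    have 2: "y x = P.val (l\<^sup>2) 1 \<beta> x + \<i> * of_real \<alpha> * l * s" "y' x = P'.val (l\<^sup>2) 1 \<beta>' x + \<i> * of_real \<alpha> * l * s'"
      unfolding y_def y'_def s_def s'_def P.val_h[OF x] P'.val_h[OF x] using \<alpha> by simp_all
    have "P.\<Delta> l * G l = y (a - x) * y' x - y x * y' (a - x)"
      using 1 2 unfolding G_def s_def[symmetric] s'_def[symmetric] by algebra
    then have "norm (P.\<Delta> l) * norm (G l) \<le> norm (y (a - x)) * norm (y' x) + norm (y x) * norm (y' (a - x))"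
      by (metis norm_mult norm_triangle_ineq4)
    also have "\<dots> \<le> (2 * P.B * exp (\<bar>Im l\<bar> * (a - x))) * (2 * P'.B * exp (\<bar>Im l\<bar> * x)) +
       (2 * P.B * exp (\<bar>Im l\<bar> * x)) * (2 * P'.B * exp (\<bar>Im l\<bar> * (a - x)))"
      unfolding y_def y'_def
      by (intro add_mono mult_mono P.asymptotics(1) P'.asymptotics(1) P.h_bound P'.h_bound lR x ax)
         (use P.B_ge P'.B_ge in auto)
    also have "\<dots> = 8 * P.B * P'.B * (exp (\<bar>Im l\<bar> * (a - x)) * exp (\<bar>Im l\<bar> * x))" by simp
    also have "exp (\<bar>Im l\<bar> * (a - x)) * exp (\<bar>Im l\<bar> * x) = exp (\<bar>Im l\<bar> * a)"
      by (simp add: exp_add[symmetric] algebra_simps)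
    finally have "norm (P.\<Delta> l) * norm (G l) \<le> 8 * P.B * P'.B * exp (\<bar>Im l\<bar> * a)" .
    moreover have "\<alpha> * norm l * exp (\<bar>Im l\<bar> * a) * norm (G l) \<le> norm (P.\<Delta> l) * norm (G l)"
      by (intro mult_right_mono P.\<Delta>_lower) (use l im in auto)
    ultimately have "(\<alpha> * norm l * exp (\<bar>Im l\<bar> * a)) * norm (G l) \<le> 8 * P.B * P'.B * exp (\<bar>Im l\<bar> * a)"
      by linarith
    moreover have "(\<alpha> * norm l * exp (\<bar>Im l\<bar> * a)) * norm (G l) = (\<alpha> * norm l * norm (G l)) * exp (\<bar>Im l\<bar> * a)"
      by (simp add: mult_ac)
    ultimately have "(\<alpha> * norm l * norm (G l)) * exp (\<bar>Im l\<bar> * a) \<le> 8 * P.B * P'.B * exp (\<bar>Im l\<bar> * a)"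
      by linarith
    then have "\<alpha> * norm l * norm (G l) \<le> 8 * P.B * P'.B" by simp
    then show ?thesis using P.\<alpha> l0 by (simp add: C_def field_simps)
  qed
  have Gb: "norm (G l) \<le> C / norm l" if l: "norm l \<ge> max P.R1 P'.R1" for l
  proof (cases "Im l \<le> 0")
    case False
    have "G l = G (- l)" by (simp add: G_def)
    then show ?thesis using lower[of "- l"] l False by simp
  qed (rule lower[OF l])
  have hol: "G holomorphic_on UNIV"
    unfolding G_def[abs_def]
    by (intro holomorphic_on_diff holomorphic_on_mult holomorphic_comp_square[OF P.holomorphic_val(1)] holomorphic_comp_square[OF P'.holomorphic_val(1)] x)
  have "(G \<longlongrightarrow> 0) at_infinity"
    unfolding Lim_at_infinity
  proof (intro allI impI)
    fix e :: real assume e: "e > 0"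
    show "\<exists>b. \<forall>l. b \<le> norm l \<longrightarrow> dist (G l) 0 < e"
    proof (intro exI allI impI)
      fix l :: complex assume l: "max (max P.R1 P'.R1) (C / e + 1) \<le> norm l"
      then have "C / e < norm l" by linarith
      then have "C < e * norm l" using e by (simp add: pos_divide_less_eq mult.commute)
      moreover have "norm l > 0" using l R by linarith
      ultimately have "C / norm l < e" by (simp add: pos_divide_less_eq)
      moreover have "norm (G l) \<le> C / norm l" using l by (intro Gb) linarith
      ultimately show "dist (G l) 0 < e" by simp
    qed
  qed
  from Liouville_weak_0[OF hol this] show ?thesis by (simp add: G_def)
qed

text \<open>One spectral parameter \<open>l = i t\<close> with \<open>t\<close> large suffices. The vanishing cross product and its
  derivative in \<open>x\<close>, with the two Wronskians, give \<open>\<phi>\<^sup>2 = \<psi>\<^sup>2\<close>; both functions stay within a quarter of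
  \<open>cosh (t x)\<close>, so \<open>\<phi> = \<psi>\<close> without zeros, and the equation determines the potential.\<close>

theorem uniqueness: "\<alpha> = \<alpha>' \<and> \<beta> = \<beta>' \<and> (AE x in lebesgue_on {0<..<a}. q x = q' x)"
proof -
  define k where "k = 2 * P.B * P.Q + norm \<beta>"
  define k' where "k' = 2 * P'.B * P'.Q + norm \<beta>'"
  have kk: "k \<ge> 0" "k' \<ge> 0" using P.B_ge P.Q_nonneg P'.B_ge P'.Q_nonneg by (simp_all add: k_def k'_def)
  \<comment> \<open>The factor \<open>8\<close> keeps both solutions within \<open>e\<^bsup>t x\<^esup> / 8\<close> of \<open>cosh (t x)\<close>, which is at least \<open>e\<^bsup>t x\<^esup> / 2\<close>.\<close>
  define t where "t = max (max P.R P'.R) (8 * (k + k'))"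
  have t: "t \<ge> P.R" "t \<ge> P'.R" "t \<ge> 8 * (k + k')" by (auto simp: t_def)
  have t1: "t \<ge> 1" using t(1) P.Q_nonneg by (simp add: P.R_def)
  define z where "z = - (complex_of_real t)\<^sup>2"
  define \<phi> \<psi> where "\<phi> = P.val z 1 \<beta>" and "\<psi> = P'.val z 1 \<beta>'"
  define d\<phi> d\<psi> where "d\<phi> = P.der z 1 \<beta>" and "d\<psi> = P'.der z 1 \<beta>'"
  define s r where "s = P.val z 0 1" and "r = P'.val z 0 1"
  define ds dr where "ds = P.der z 0 1" and "dr = P'.der z 0 1"
  note defs = \<phi>_def \<psi>_def d\<phi>_def d\<psi>_def s_def r_def ds_def dr_def
  have sols: "schroedinger_solution a (\<lambda>t. q t - z) \<phi> d\<phi>" "schroedinger_solution a (\<lambda>t. q t - z) s ds"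
    "schroedinger_solution a (\<lambda>t. q' t - z) \<psi> d\<psi>" "schroedinger_solution a (\<lambda>t. q' t - z) r dr"
    unfolding defs by (rule P.sol P'.sol)+
  have cont: "continuous_on {0..a} \<phi>" "continuous_on {0..a} d\<phi>" "continuous_on {0..a} s" "continuous_on {0..a} ds"
    "continuous_on {0..a} \<psi>" "continuous_on {0..a} d\<psi>" "continuous_on {0..a} r" "continuous_on {0..a} dr"
    using sols schroedinger_continuous by blast+
  have prim: "primitive_on a \<phi> d\<phi>" "primitive_on a s ds" "primitive_on a \<psi> d\<psi>" "primitive_on a r dr"
    using sols by (auto simp: schroedinger_solution_def)
  have G: "\<phi> x * r x - s x * \<psi> x = 0" if x: "x \<in> {0..a}" for x
  proof -
    have "z = (\<i> * of_real t)\<^sup>2" by (simp add: z_def power_mult_distrib)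
    then show ?thesis using cross_product_vanishes[OF x, of "\<i> * of_real t"] by (simp add: defs)
  qed
  have deriv_zero: "f x = 0" if f: "primitive_on a F f" "continuous_on {0..a} f"
    and z: "\<And>y. y \<in> {0..a} \<Longrightarrow> F y = 0" and x: "x \<in> {0..a}" for F f x
  proof -
    have "(F has_vector_derivative f x) (at x within {0..a})"
      by (rule primitive_on_has_vector_derivative[OF f x])
    moreover have "(F has_vector_derivative 0) (at x within {0..a})"
      by (rule has_vector_derivative_transform[OF x _ has_vector_derivative_const[of 0]]) (rule z)
    ultimately show ?thesis
      using vector_derivative_unique_within_closed_interval[of 0 a x F "f x" 0] P.a x by simp
  qed
  have sq: "(\<phi> x)\<^sup>2 = (\<psi> x)\<^sup>2" if x: "x \<in> {0..a}" for x
  proof -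
    let ?g = "\<lambda>x. (d\<phi> x * r x + \<phi> x * dr x) - (ds x * \<psi> x + s x * d\<psi> x)"
    have "primitive_on a (\<lambda>x. \<phi> x * r x - s x * \<psi> x) ?g"
      by (rule primitive_on_cong[OF primitive_on_lincomb[OF primitive_on_mult[OF prim(1,4)] primitive_on_mult[OF prim(2,3)], of 1 "-1"]])
         auto
    moreover have "continuous_on {0..a} ?g" by (intro continuous_intros cont)
    ultimately have g: "?g x = 0" by (rule deriv_zero) (use G x in auto)
    have W: "\<phi> x * ds x - d\<phi> x * s x = 1"
      using wronskian_constant[OF sols(1,2) x] by (simp add: defs P.sol)
    have W': "\<psi> x * dr x - d\<psi> x * r x = 1"
      using wronskian_constant[OF sols(3,4) x] by (simp add: defs P'.sol)
    show ?thesis using g W W' G[OF x] by algebra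
  qed
  have close: "norm (\<phi> x - of_real (cosh (t * x))) \<le> exp (t * x) / 8"
    "norm (\<psi> x - of_real (cosh (t * x))) \<le> exp (t * x) / 8" if x: "x \<in> {0..a}" for x
  proof -
    have "k / t \<le> 1 / 8" "k' / t \<le> 1 / 8" using t t1 kk by (simp_all add: field_simps)
    from mult_right_mono[OF this(1), of "exp (t * x)"] mult_right_mono[OF this(2), of "exp (t * x)"]
    have "k / t * exp (t * x) \<le> exp (t * x) / 8" "k' / t * exp (t * x) \<le> exp (t * x) / 8" by simp_all
    then show "norm (\<phi> x - of_real (cosh (t * x))) \<le> exp (t * x) / 8"
      "norm (\<psi> x - of_real (cosh (t * x))) \<le> exp (t * x) / 8"
      using P.imaginary_axis(1)[OF t(1) x] P'.imaginary_axis(1)[OF t(2) x]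
      unfolding defs z_def k_def[symmetric] k'_def[symmetric] by (meson order_trans)+
  qed
  have ch: "exp (t * x) / 2 \<le> cosh (t * x)" for x by (simp add: cosh_def)
  have nz: "\<phi> x \<noteq> 0" and eq: "\<phi> x = \<psi> x" if x: "x \<in> {0..a}" for x
  proof -
    have e: "exp (t * x) > 0" by simp
    have nc: "norm (complex_of_real (cosh (t * x))) = cosh (t * x)" by simp
    show "\<phi> x \<noteq> 0"
    proof
      assume "\<phi> x = 0"
      then have "cosh (t * x) \<le> exp (t * x) / 8" using close(1)[OF x] by simp
      then show False using ch[of x] e by linarith
    qed
    have "\<phi> x + \<psi> x \<noteq> 0"
    proof
      assume 0: "\<phi> x + \<psi> x = 0"
      have "2 * complex_of_real (cosh (t * x)) = - ((\<phi> x - of_real (cosh (t * x))) + (\<psi> x - of_real (cosh (t * x))))"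
        using 0 by (simp add: algebra_simps)
      then have "norm (2 * complex_of_real (cosh (t * x))) \<le> norm (\<phi> x - of_real (cosh (t * x))) + norm (\<psi> x - of_real (cosh (t * x)))"
        by (metis norm_minus_cancel norm_triangle_ineq)
      then have "2 * cosh (t * x) \<le> exp (t * x) / 8 + exp (t * x) / 8"
        using close[OF x] by (simp add: norm_mult)
      then show False using ch[of x] e by linarith
    qed
    moreover have "(\<phi> x + \<psi> x) * (\<phi> x - \<psi> x) = 0" using sq[OF x] by (simp add: algebra_simps power2_eq_square)
    ultimately show "\<phi> x = \<psi> x" by simp
  qed
  have deq: "d\<phi> x = d\<psi> x" if x: "x \<in> {0..a}" for x
  proof -
    have "primitive_on a (\<lambda>x. \<phi> x - \<psi> x) (\<lambda>x. d\<phi> x - d\<psi> x)"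
      using primitive_on_lincomb[OF prim(1,3), of 1 "-1"] by simp
    moreover have "continuous_on {0..a} (\<lambda>x. d\<phi> x - d\<psi> x)" by (intro continuous_intros cont)
    ultimately have "d\<phi> x - d\<psi> x = 0" by (rule deriv_zero) (use eq x in auto)
    then show ?thesis by simp
  qed
  have \<beta>: "\<beta> = \<beta>'" using deq[of 0] P.a by (simp add: defs P.sol P'.sol)
  let ?f = "\<lambda>x. (q x - z) * \<phi> x - (q' x - z) * \<psi> x"
  have f: "primitive_on a (\<lambda>x. d\<phi> x - d\<psi> x) ?f"
    using primitive_on_lincomb[of a d\<phi> "\<lambda>x. (q x - z) * \<phi> x" d\<psi> "\<lambda>x. (q' x - z) * \<psi> x" 1 "-1"] sols(1,3)
    by (simp add: schroedinger_solution_def)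
  have "AE x in lebesgue_on {0<..<a}. ?f x = 0"
  proof (rule AE_zero_if_integrals_zero)
    show "?f absolutely_integrable_on {0..a}" using f by (simp add: primitive_on_def)
    show "integral {0..x} ?f = 0" if "x \<in> {0..a}" for x
    proof -
      have "(?f has_integral (d\<phi> x - d\<psi> x) - (d\<phi> 0 - d\<psi> 0)) {0..x}" using f that by (simp add: primitive_on_def)
      moreover have "d\<phi> x = d\<psi> x" "d\<phi> 0 = d\<psi> 0" using deq that P.a by auto
      ultimately show ?thesis by (simp add: integral_unique)
    qed
  qed (use P.a in simp)
  moreover have "AE x in lebesgue_on {0<..<a}. x \<in> {0<..<a}"
    using AE_space[of "lebesgue_on {0<..<a}"] by simp
  ultimately have "AE x in lebesgue_on {0<..<a}. q x = q' x"
  proof eventually_elim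
    case (elim x)
    have x: "x \<in> {0..a}" using elim(2) by auto
    have "(q x - q' x) * \<phi> x = 0" using elim(1) unfolding eq[OF x, symmetric] by (simp add: algebra_simps)
    then show ?case using nz[OF x] by simp
  qed
  then show ?thesis using invariants_eq \<beta> by simp
qed

end

theorem theorem3:
  fixes a :: real
    and q q' :: "real \<Rightarrow> complex"
    and \<alpha>\<^sub>0 \<alpha> \<alpha>\<^sub>0' \<alpha>' :: real
    and \<beta>\<^sub>0 \<beta> \<beta>\<^sub>0' \<beta>' :: complex
  assumes "a > 0"
    and "L2_on a q" and "\<alpha>\<^sub>0 \<ge> 0" and "\<alpha> > 0"
    and "char_fun a q \<alpha>\<^sub>0 \<beta>\<^sub>0 \<alpha> \<beta> 0 \<noteq> 0"
    and "AE x in lebesgue_on {0<..<a}. q x = q (a - x)"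
    and "\<alpha> = \<alpha>\<^sub>0" and "\<beta> = \<beta>\<^sub>0"
    and "L2_on a q'" and "\<alpha>\<^sub>0' \<ge> 0" and "\<alpha>' > 0"
    and "char_fun a q' \<alpha>\<^sub>0' \<beta>\<^sub>0' \<alpha>' \<beta>' 0 \<noteq> 0"
    and "AE x in lebesgue_on {0<..<a}. q' x = q' (a - x)"
    and "\<alpha>' = \<alpha>\<^sub>0'" and "\<beta>' = \<beta>\<^sub>0'"
    and "eigenvalues a q \<alpha>\<^sub>0 \<beta>\<^sub>0 \<alpha> \<beta> = eigenvalues a q' \<alpha>\<^sub>0' \<beta>\<^sub>0' \<alpha>' \<beta>'"
    and "\<And>\<mu>. \<mu> \<in> eigenvalues a q \<alpha>\<^sub>0 \<beta>\<^sub>0 \<alpha> \<beta> \<Longrightarrow>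
           eigenvalue_mult a q \<alpha>\<^sub>0 \<beta>\<^sub>0 \<alpha> \<beta> \<mu> = eigenvalue_mult a q' \<alpha>\<^sub>0' \<beta>\<^sub>0' \<alpha>' \<beta>' \<mu>"
  shows "\<alpha> = \<alpha>' \<and> \<beta> = \<beta>' \<and> (AE x in lebesgue_on {0<..<a}. q x = q' x)"
proof -
  note eqs = \<open>\<alpha> = \<alpha>\<^sub>0\<close>[symmetric] \<open>\<beta> = \<beta>\<^sub>0\<close>[symmetric] \<open>\<alpha>' = \<alpha>\<^sub>0'\<close>[symmetric] \<open>\<beta>' = \<beta>\<^sub>0'\<close>[symmetric]
  \<comment> \<open>The equal parameters at the two ends are identified before the two problems are compared.\<close>
  interpret P: symmetric_problem a q \<alpha> \<beta>
    by unfold_locales (use assms L2_on_absolutely_integrable in auto)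
  interpret P': symmetric_problem a q' \<alpha>' \<beta>'
    by unfold_locales (use assms L2_on_absolutely_integrable in auto)
  have ev: "eigenvalues a q \<alpha> \<beta> \<alpha> \<beta> = eigenvalues a q' \<alpha>' \<beta>' \<alpha>' \<beta>'"
    using assms(16) unfolding eqs .
  have em: "eigenvalue_mult a q \<alpha> \<beta> \<alpha> \<beta> \<mu> = eigenvalue_mult a q' \<alpha>' \<beta>' \<alpha>' \<beta>' \<mu>"
    if "\<mu> \<in> eigenvalues a q \<alpha> \<beta> \<alpha> \<beta>" for \<mu>
    using assms(17) that unfolding eqs .
  interpret isospectral_pair a q \<alpha> \<beta> q' \<alpha>' \<beta>'
  proof unfold_locales
    show "P.\<Delta> 0 \<noteq> 0" using assms(5) unfolding eqs P.\<Delta>_def .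
    show "P.\<Delta> l = 0 \<longleftrightarrow> P'.\<Delta> l = 0" for l
      using ev unfolding eigenvalues_def P.\<Delta>_def P'.\<Delta>_def by blast
    show "zorder P.\<Delta> l = zorder P'.\<Delta> l" if "P.\<Delta> l = 0" for l
      using em[of l] that unfolding eigenvalues_def eigenvalue_mult_def P.\<Delta>_def P'.\<Delta>_def by blast
  qed
  show ?thesis by (rule uniqueness)
qed

end
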